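(* There exists a universal constant $c>0$ such that for all natural numbers $d\ge1$ and $n\ge2$, $$\sup_{M}\ \frac{\sup_{P_n\in\mathcal{Q}_n}|\langle M,P_n\rangle|}{\sup_{P_d\in\mathcal{Q}_d}|\langle M,P_d\rangle|}\ \ge\ c\,\frac{\sqrt n}{d\,\log^2n},$$ where the outer supremum is over all Bell inequalities $M=M_{d,n}$, with arbitrary finite numbers of inputs and outputs, for which the denominator is nonzero.
   Context: For $N$ inputs and $K$ outputs per site, a Bell inequality is a real family $M=(M_{x,y}^{a,b})$, $x,y\in\{1,\dots,N\}$, $a,b\in\{1,\dots,K\}$, acting on families $P=(P(a,b|x,y))$ by $\langle M,P\rangle=\sum_{x,y,a,b}M_{x,y}^{a,b}P(a,b|x,y)$. For $d\in\mathbb{N}$, $\mathcal{Q}_d$ is the set of $P$ of the form $P(a,b|x,y)=\mathrm{tr}\big((E_x^a\otimes F_y^b)\rho\big)$, where $H_1,H_2$ are $d$-dimensional Hilbert spaces, $\rho$ is a density operator on $H_1\otimes H_2$, $E_x^a\in B(H_1)$ and $F_y^b\in B(H_2)$ are positive semidefinite, $\sum_aE_x^a=\mathbb{1}$ for every $x$ and $\sum_bF_y^b=\mathbb{1}$ for every $y$ (with the same numbers of inputs and outputs as the $M$ it is paired with). $\log$ is the logarithm in base $2$ (the choice of base only affects $c$). *)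

theory Defs
  imports
    Complex_Main
    "HOL-Library.Extended_Real"
    "Jordan_Normal_Form.Matrix"
begin

text \<open>
  The dimension is a bound variable of the statement, so a \<open>d\<close>-dimensional Hilbert space is
  represented by its coordinates in an orthonormal basis, and operators on it by complex matrices
  in \<open>carrier_mat d d\<close>. The tensor product of two such spaces has dimension \<open>d * d\<close>, with the
  basis vector $e_i \otimes e_k$ at position \<open>i * d + k\<close>.
\<close>

definition trace :: "'a :: comm_monoid_add mat \<Rightarrow> 'a" where
  "trace A = (\<Sum>i<dim_row A. A $$ (i, i))"

definition kronecker :: "'a :: times mat \<Rightarrow> 'a mat \<Rightarrow> 'a mat" where
  "kronecker A B = mat (dim_row A * dim_row B) (dim_col A * dim_col B)
     (\<lambda>(i, j). A $$ (i div dim_row B, j div dim_col B) * B $$ (i mod dim_row B, j mod dim_col B))"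

text \<open>
  In the order on \<^typ>\<open>complex\<close> used by the matrix library, \<open>0 \<le> z\<close> says that \<open>z\<close> is real and
  nonnegative; hence the condition below forces the matrix to be Hermitian.
\<close>

definition positive_semidefinite :: "nat \<Rightarrow> complex mat \<Rightarrow> bool" where
  "positive_semidefinite d A \<longleftrightarrow>
     A \<in> carrier_mat d d \<and> (\<forall>v \<in> carrier_vec d. 0 \<le> (A *\<^sub>v v) \<bullet>c v)"

definition density_operator :: "nat \<Rightarrow> complex mat \<Rightarrow> bool" where
  "density_operator d \<rho> \<longleftrightarrow> positive_semidefinite d \<rho> \<and> trace \<rho> = 1"

text \<open>A measurement with \<open>K\<close> outcomes (POVM); the sum of operators is written entrywise.\<close>

definition povm :: "nat \<Rightarrow> nat \<Rightarrow> (nat \<Rightarrow> complex mat) \<Rightarrow> bool" where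
  "povm d K E \<longleftrightarrow>
     (\<forall>a \<in> {1..K}. positive_semidefinite d (E a)) \<and>
     mat d d (\<lambda>(i, j). \<Sum>a = 1..K. E a $$ (i, j)) = 1\<^sub>m d"

text \<open>
  \<open>P a b x y\<close> stands for $P(a,b|x,y)$. Values of \<open>P\<close> (and of \<open>M\<close> below) at indices outside
  \<open>{1..K}\<close> and \<open>{1..N}\<close> are unconstrained; they do not enter the pairing.
\<close>

definition quantum_set ::
    "nat \<Rightarrow> nat \<Rightarrow> nat \<Rightarrow> (nat \<Rightarrow> nat \<Rightarrow> nat \<Rightarrow> nat \<Rightarrow> real) set" where
  "quantum_set d N K = {P. \<exists>E F \<rho>.
     density_operator (d * d) \<rho> \<and>
     (\<forall>x \<in> {1..N}. povm d K (E x)) \<and>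
     (\<forall>y \<in> {1..N}. povm d K (F y)) \<and>
     (\<forall>x \<in> {1..N}. \<forall>y \<in> {1..N}. \<forall>a \<in> {1..K}. \<forall>b \<in> {1..K}.
        complex_of_real (P a b x y) = trace (kronecker (E x a) (F y b) * \<rho>))}"

text \<open>The coefficient $M_{x,y}^{a,b}$ is \<open>M x y a b\<close>.\<close>

definition bell_pairing ::
    "nat \<Rightarrow> nat \<Rightarrow> (nat \<Rightarrow> nat \<Rightarrow> nat \<Rightarrow> nat \<Rightarrow> real) \<Rightarrow>
     (nat \<Rightarrow> nat \<Rightarrow> nat \<Rightarrow> nat \<Rightarrow> real) \<Rightarrow> real" where
  "bell_pairing N K M P =
     (\<Sum>x = 1..N. \<Sum>y = 1..N. \<Sum>a = 1..K. \<Sum>b = 1..K. M x y a b * P a b x y)"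

text \<open>
  The suprema are taken in \<^typ>\<open>ereal\<close>, so that no boundedness is presupposed.
\<close>

definition quantum_value ::
    "nat \<Rightarrow> nat \<Rightarrow> nat \<Rightarrow> (nat \<Rightarrow> nat \<Rightarrow> nat \<Rightarrow> nat \<Rightarrow> real) \<Rightarrow> ereal" where
  "quantum_value d N K M = (SUP P \<in> quantum_set d N K. ereal \<bar>bell_pairing N K M P\<bar>)"

end

theory Submission
  imports Defs "HOL-Analysis.Convex"
begin

text \<open>
  The inputs are the sign vectors $s \in \{\pm1\}^n$, the outputs are $1, \dots, n$, and the
  functional pairs the degree-two features $s_i s_j e^{2 \pi \mathrm{i} a (j - i)/n}$, $i < j$, of the two
  sides. On the maximally entangled state of dimension $n$, measured in the Fourier bases twisted
  by $s$, it is at least $N^2 n / 4$, where $N = 2^n$. For classical strategies the features are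
  tested against coefficients bounded in $\ell_1$ over the outputs; duality and the fourth moment
  bound for degree-two Rademacher chaoses give at most $O(\sqrt n N^2)$. A strategy of dimension
  $d$, expanded in coordinates against a Gram decomposition of the state, is a combination of
  classical ones and costs a factor $O(d)$. No logarithm is lost.
\<close>

section \<open>Moments of sign chaoses\<close>

text \<open>The functional is read off from the strategy that it rewards. In sign-twisted Fourier
  bases an outcome probability is |sum_i e_i z_i|^2 / n^3 with signs e_i and phases z_i, and the
  off-diagonal part of this square is twice the functional. Hence the chaos has degree two, and the
  pairing essentially becomes the sum of squares of the functional, which is bounded below through
  the diagonal of the Gram matrix of the features. The gap to the classical side depends on which
  moment is used. The maximum over n outputs is estimated by an l_p sum, and the squared norm of the
  tested features then grows like n^(2/p). The second moment would give order n, the same as the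
  quantum value; the fourth gives sqrt n. Classical here does not mean probabilities: only the l1
  bound over the outputs is used, so the same estimate applies, after splitting into real and
  imaginary parts, to the complex coefficients that arise in dimension d.\<close>

text \<open>The inputs are numbered from \<open>1\<close>, hence the shift.\<close>

definition rsign :: "nat \<Rightarrow> nat \<Rightarrow> real" where
  "rsign i x = (if even ((x - 1) div 2 ^ i) then 1 else -1)"

lemma rsign_square [simp]: "rsign i x * rsign i x = 1" "(rsign i x)\<^sup>2 = 1"
  by (auto simp: rsign_def)

text \<open>Signs are the binary digits of \<open>x - 1\<close>, and adding \<open>2 ^ n\<close>
  does not touch the digits below \<open>n\<close>. So the cube of dimension \<open>n + 1\<close> is
  two copies of the cube of dimension \<open>n\<close> that differ only in sign \<open>n\<close>;
  all inductions on \<open>n\<close> below rest on this.\<close>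

lemma rsign_shift:
  assumes "i < n" "x \<ge> 1"
  shows "rsign i (2 ^ n + x) = rsign i x"
proof -
  have "(2::nat) ^ n = 2 ^ i * (2 * 2 ^ (n - i - 1))"
    using assms by (simp flip: power_Suc power_add)
  then have "(2 ^ n + (x - 1)) div 2 ^ i = 2 * 2 ^ (n - i - 1) + (x - 1) div 2 ^ i"
    by simp
  then show ?thesis using assms by (simp add: rsign_def)
qed

lemma rsign_top:
  assumes "x \<in> {1..2 ^ n}"
  shows "rsign n x = 1" "rsign n (2 ^ n + x) = -1"
proof -
  obtain y where y: "x = Suc y" "y < 2 ^ n"
    using assms by (cases x) auto
  then show "rsign n x = 1" "rsign n (2 ^ n + x) = -1"
    by (simp_all add: rsign_def)
qed

lemma sum_power2_Suc:
  fixes f :: "nat \<Rightarrow> 'a::comm_monoid_add"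
  shows "(\<Sum>x = 1..2 ^ Suc n. f x) = (\<Sum>x = 1..2 ^ n. f x + f (2 ^ n + x))"
proof -
  have "(\<Sum>x = 1..2 ^ Suc n. f x) = sum f {1..2 ^ n} + sum f {2 ^ n + 1..2 ^ n + 2 ^ n}"
    using sum.ub_add_nat[of 1 "2 ^ n" f "2 ^ n"] by (simp add: mult_2)
  also have "sum f {2 ^ n + 1..2 ^ n + 2 ^ n} = (\<Sum>x = 1..2 ^ n. f (2 ^ n + x))"
    using sum.shift_bounds_cl_nat_ivl[of f 1 "2 ^ n" "2 ^ n"] by (simp add: add.commute)
  finally show ?thesis by (simp add: sum.distrib)
qed

text \<open>Averaging over the newest sign: \<open>H\<close> is the part multiplied by that sign, so
  odd powers of \<open>H\<close> cancel between the two halves of the cube.\<close>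

lemma rademacher_moments_step:
  fixes F F' H :: "nat \<Rightarrow> real"
  assumes "\<And>x. x \<in> {1..2 ^ n} \<Longrightarrow> F' x = F x + H x"
    and "\<And>x. x \<in> {1..2 ^ n} \<Longrightarrow> F' (2 ^ n + x) = F x - H x"
  shows "(\<Sum>x = 1..2 ^ Suc n. F' x ^ 2) = 2 * (\<Sum>x = 1..2 ^ n. F x ^ 2) + 2 * (\<Sum>x = 1..2 ^ n. H x ^ 2)"
    and "(\<Sum>x = 1..2 ^ Suc n. F' x ^ 4) =
      2 * (\<Sum>x = 1..2 ^ n. F x ^ 4) + 12 * (\<Sum>x = 1..2 ^ n. F x ^ 2 * H x ^ 2) + 2 * (\<Sum>x = 1..2 ^ n. H x ^ 4)"
proof -
  have *: "(a + b)\<^sup>2 + (a - b)\<^sup>2 = 2 * a\<^sup>2 + 2 * b\<^sup>2"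
      "(a + b) ^ 4 + (a - b) ^ 4 = 2 * a ^ 4 + 12 * (a\<^sup>2 * b\<^sup>2) + 2 * b ^ 4" for a b :: real
    by (simp_all add: power2_eq_square power4_eq_xxxx algebra_simps)
  show "(\<Sum>x = 1..2 ^ Suc n. F' x ^ 2) = 2 * (\<Sum>x = 1..2 ^ n. F x ^ 2) + 2 * (\<Sum>x = 1..2 ^ n. H x ^ 2)"
    unfolding sum_power2_Suc sum_distrib_left sum.distrib[symmetric]
    by (intro sum.cong refl) (simp only: assms *)
  show "(\<Sum>x = 1..2 ^ Suc n. F' x ^ 4) =
      2 * (\<Sum>x = 1..2 ^ n. F x ^ 4) + 12 * (\<Sum>x = 1..2 ^ n. F x ^ 2 * H x ^ 2) + 2 * (\<Sum>x = 1..2 ^ n. H x ^ 4)"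
    unfolding sum_power2_Suc sum_distrib_left sum.distrib[symmetric]
    by (intro sum.cong refl) (simp only: assms *)
qed

lemma rademacher_step:
  fixes a :: "nat \<Rightarrow> real"
  assumes "x \<in> {1..2 ^ n}"
  shows "(\<Sum>i<Suc n. a i * rsign i x) = (\<Sum>i<n. a i * rsign i x) + a n"
    and "(\<Sum>i<Suc n. a i * rsign i (2 ^ n + x)) = (\<Sum>i<n. a i * rsign i x) - a n"
  using assms by (simp_all add: rsign_shift rsign_top)

lemma rademacher_second_moment:
  "(\<Sum>x = 1..2 ^ n. (\<Sum>i<n. a i * rsign i x)\<^sup>2) = 2 ^ n * (\<Sum>i<n. (a i)\<^sup>2)"
proof (induction n)
  case (Suc n)
  show ?case
    by (subst rademacher_moments_step(1)[where F = "\<lambda>x. \<Sum>i<n. a i * rsign i x" and H = "\<lambda>_. a n"])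
       (simp_all only: rademacher_step Suc.IH, simp add: distrib_left)
qed simp

text \<open>Khintchine's inequality with the Gaussian constant. The 3 is dictated by the mixed term:
  the step produces \<open>12 * V * (a n)^2\<close>, which is exactly the mixed term of
  \<open>6 * (V + (a n)^2)^2\<close>; only the pure fourth power has slack.\<close>

lemma rademacher_fourth_moment:
  "(\<Sum>x = 1..2 ^ n. (\<Sum>i<n. a i * rsign i x) ^ 4) \<le> 3 * 2 ^ n * (\<Sum>i<n. (a i)\<^sup>2)\<^sup>2"
proof (induction n)
  case (Suc n)
  define V where "V = (\<Sum>i<n. (a i)\<^sup>2)"
  have "(\<Sum>x = 1..2 ^ Suc n. (\<Sum>i<Suc n. a i * rsign i x) ^ 4)
      = 2 * (\<Sum>x = 1..2 ^ n. (\<Sum>i<n. a i * rsign i x) ^ 4)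
        + 12 * (\<Sum>x = 1..2 ^ n. (\<Sum>i<n. a i * rsign i x)\<^sup>2 * (a n)\<^sup>2) + 2 * (\<Sum>x = 1..(2::nat) ^ n. a n ^ 4)"
    by (subst rademacher_moments_step(2)[where F = "\<lambda>x. \<Sum>i<n. a i * rsign i x" and H = "\<lambda>_. a n"])
       (simp_all add: rademacher_step del: sum.lessThan_Suc)
  also have "\<dots> \<le> 2 * (3 * 2 ^ n * V\<^sup>2) + 12 * (2 ^ n * V * (a n)\<^sup>2) + 2 * (2 ^ n * a n ^ 4)"
    unfolding sum_distrib_right[symmetric] rademacher_second_moment
    using Suc.IH by (simp add: V_def)
  also have "\<dots> \<le> 3 * 2 ^ Suc n * (V + (a n)\<^sup>2)\<^sup>2"
  proof -
    have "3 * 2 ^ Suc n * (V + (a n)\<^sup>2)\<^sup>2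
        - (2 * (3 * 2 ^ n * V\<^sup>2) + 12 * (2 ^ n * V * (a n)\<^sup>2) + 2 * (2 ^ n * a n ^ 4)) = 2 ^ n * (4 * a n ^ 4)"
      by (simp add: power2_eq_square power4_eq_xxxx algebra_simps)
    moreover have "(0::real) \<le> 2 ^ n * (4 * a n ^ 4)" by simp
    ultimately show ?thesis by linarith
  qed
  finally show ?case by (simp add: V_def)
qed simp

text \<open>Splitting off the terms with \<open>j = n\<close> leaves a linear form \<open>L\<close>
  multiplied by the newest sign. A constant C closes the induction once 12 sqrt (3 C) <= 4 C, where
  3 is the constant for linear forms; equality gives C = 27.\<close>

lemma rademacher_chaos_fourth_moment:
  fixes c :: "nat \<Rightarrow> nat \<Rightarrow> real"
  shows "(\<Sum>x = 1..2 ^ n. (\<Sum>j<n. \<Sum>i<j. c i j * (rsign i x * rsign j x)) ^ 4)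
    \<le> 27 * 2 ^ n * (\<Sum>j<n. \<Sum>i<j. (c i j)\<^sup>2)\<^sup>2"
proof (induction n)
  case (Suc n)
  define Q where "Q = (\<lambda>n x. \<Sum>j<n. \<Sum>i<j. c i j * (rsign i x * rsign j x))"
  define L where "L = (\<lambda>x. \<Sum>i<n. c i n * rsign i x)"
  define V where "V = (\<Sum>j<n. \<Sum>i<j. (c i j)\<^sup>2)"
  define W where "W = (\<Sum>i<n. (c i n)\<^sup>2)"
  have nonneg: "V \<ge> 0" "W \<ge> 0"
    by (simp_all add: V_def W_def sum_nonneg)
  have step: "Q (Suc n) x = Q n x + L x" "Q (Suc n) (2 ^ n + x) = Q n x - L x" if "x \<in> {1..2 ^ n}" for x
    using that by (simp_all add: Q_def L_def rsign_shift rsign_top sum_negf)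
  have Q4: "(\<Sum>x = 1..2 ^ n. Q n x ^ 4) \<le> 27 * 2 ^ n * V\<^sup>2"
    using Suc.IH by (simp add: Q_def V_def)
  have L4: "(\<Sum>x = 1..2 ^ n. L x ^ 4) \<le> 3 * 2 ^ n * W\<^sup>2"
    unfolding L_def W_def by (rule rademacher_fourth_moment)
  \<comment> \<open>\<open>Q n\<close> and \<open>L\<close> depend on the same signs, so the mixed
    moment does not factor; Cauchy-Schwarz reduces it to the two fourth moments.\<close>
  have "(\<Sum>x = 1..2 ^ n. (Q n x)\<^sup>2 * (L x)\<^sup>2)\<^sup>2 \<le> (\<Sum>x = 1..2 ^ n. ((Q n x)\<^sup>2)\<^sup>2) * (\<Sum>x = 1..2 ^ n. ((L x)\<^sup>2)\<^sup>2)"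
    by (rule Cauchy_Schwarz_ineq_sum)
  also have "\<dots> \<le> (27 * 2 ^ n * V\<^sup>2) * (3 * 2 ^ n * W\<^sup>2)"
    using Q4 L4 by (intro mult_mono) (simp_all add: sum_nonneg flip: power_mult)
  also have "\<dots> = (9 * 2 ^ n * V * W)\<^sup>2"
    by (simp add: power2_eq_square)
  finally have "(\<Sum>x = 1..2 ^ n. (Q n x)\<^sup>2 * (L x)\<^sup>2) \<le> 9 * 2 ^ n * V * W"
    using nonneg by (blast intro: power2_le_imp_le mult_nonneg_nonneg zero_le_numeral zero_le_power)
  then have "(\<Sum>x = 1..2 ^ Suc n. Q (Suc n) x ^ 4)
      \<le> 2 * (27 * 2 ^ n * V\<^sup>2) + 12 * (9 * 2 ^ n * V * W) + 2 * (3 * 2 ^ n * W\<^sup>2)"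
    using Q4 L4 by (subst rademacher_moments_step(2)[where F = "Q n" and H = L, OF step]) auto
  also have "\<dots> \<le> 27 * 2 ^ Suc n * (V + W)\<^sup>2"
  proof -
    have "27 * 2 ^ Suc n * (V + W)\<^sup>2
        - (2 * (27 * 2 ^ n * V\<^sup>2) + 12 * (9 * 2 ^ n * V * W) + 2 * (3 * 2 ^ n * W\<^sup>2)) = 2 ^ n * (48 * W\<^sup>2)"
      by (simp add: power2_eq_square algebra_simps)
    moreover have "(0::real) \<le> 2 ^ n * (48 * W\<^sup>2)" by simp
    ultimately show ?thesis by linarith
  qed
  finally show ?case by (simp add: Q_def V_def W_def)
qed simp

text \<open>
  An index \<open>((j, i), b)\<close> stands for the real (\<open>b = True\<close>) or imaginary part of the feature of
  the pair \<open>i < j\<close>.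
\<close>

definition chaos_indices :: "nat \<Rightarrow> ((nat \<times> nat) \<times> bool) set" where
  "chaos_indices n = (SIGMA j:{..<n}. {..<j}) \<times> UNIV"

text \<open>The phase stays arbitrary because the classical bound uses only cos^2 + sin^2 = 1;
  Fourier phases matter only for the quantum strategy. Real and imaginary parts are separate
  features so that the functional is real.\<close>

definition chaos_feature :: "(nat \<Rightarrow> nat \<Rightarrow> nat \<Rightarrow> real) \<Rightarrow> nat \<Rightarrow> nat \<Rightarrow> (nat \<times> nat) \<times> bool \<Rightarrow> real" where
  "chaos_feature \<theta> x a = (\<lambda>((j, i), b).
     rsign i x * rsign j x * (if b then cos (\<theta> a i j) else sin (\<theta> a i j)))"

lemma finite_chaos_indices [simp]: "finite (chaos_indices n)"
  by (simp add: chaos_indices_def)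

lemma sum_chaos_indices:
  fixes f :: "(nat \<times> nat) \<times> bool \<Rightarrow> 'a::comm_monoid_add"
  shows "(\<Sum>k\<in>chaos_indices n. f k) = (\<Sum>j<n. \<Sum>i<j. f ((j, i), True) + f ((j, i), False))"
proof -
  have "(\<Sum>k\<in>chaos_indices n. f k) = (\<Sum>p\<in>(SIGMA j:{..<n}. {..<j}). f (p, True) + f (p, False))"
    by (simp add: chaos_indices_def sum.cartesian_product' UNIV_bool add.commute)
  also have "\<dots> = (\<Sum>(j, i)\<in>(SIGMA j:{..<n}. {..<j}). f ((j, i), True) + f ((j, i), False))"
    by (intro sum.cong) auto
  finally show ?thesis
    by (subst sum.Sigma) simp_all
qed

section \<open>Duality bound for coefficients bounded in l1 over the outputs\<close>

lemma sum_power4_le: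
  fixes f :: "'a \<Rightarrow> real"
  assumes "\<And>x. x \<in> X \<Longrightarrow> f x \<ge> 0"
  shows "(\<Sum>x\<in>X. f x) ^ 4 \<le> real (card X) ^ 3 * (\<Sum>x\<in>X. f x ^ 4)"
proof -
  have sq: "(\<Sum>x\<in>X. h x)\<^sup>2 \<le> real (card X) * (\<Sum>x\<in>X. (h x)\<^sup>2)" for h :: "'a \<Rightarrow> real"
    using Cauchy_Schwarz_ineq_sum[of h "\<lambda>_. 1" X] by (simp add: mult.commute)
  have "(\<Sum>x\<in>X. f x) ^ 4 = ((\<Sum>x\<in>X. f x)\<^sup>2)\<^sup>2"
    by simp
  also have "\<dots> \<le> (real (card X) * (\<Sum>x\<in>X. (f x)\<^sup>2))\<^sup>2"
    by (intro power_mono sq) simp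
  also have "\<dots> = real (card X) ^ 2 * (\<Sum>x\<in>X. (f x)\<^sup>2)\<^sup>2"
    by (simp add: power_mult_distrib)
  also have "\<dots> \<le> real (card X) ^ 2 * (real (card X) * (\<Sum>x\<in>X. ((f x)\<^sup>2)\<^sup>2))"
    by (intro mult_left_mono sq) simp
  finally show ?thesis
    by (simp add: eval_nat_numeral mult.assoc)
qed

lemma sum_abs_mult_le_Max:
  fixes f g :: "'a \<Rightarrow> real"
  assumes "finite A" "A \<noteq> {}" "(\<Sum>a\<in>A. \<bar>f a\<bar>) \<le> T"
  shows "\<bar>\<Sum>a\<in>A. f a * g a\<bar> \<le> T * Max ((\<lambda>a. \<bar>g a\<bar>) ` A)"
proof -
  define m where "m = Max ((\<lambda>a. \<bar>g a\<bar>) ` A)"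
  have le: "\<bar>g a\<bar> \<le> m" if "a \<in> A" for a
    unfolding m_def using assms(1) that by (intro Max_ge) auto
  have "m \<ge> 0"
    using le assms(2) by (meson abs_ge_zero all_not_in_conv order_trans)
  have "\<bar>\<Sum>a\<in>A. f a * g a\<bar> \<le> (\<Sum>a\<in>A. \<bar>f a\<bar> * \<bar>g a\<bar>)"
    using sum_abs[of "\<lambda>a. f a * g a" A] by (simp add: abs_mult)
  also have "\<dots> \<le> (\<Sum>a\<in>A. \<bar>f a\<bar> * m)"
    using le by (intro sum_mono mult_left_mono) auto
  also have "\<dots> = (\<Sum>a\<in>A. \<bar>f a\<bar>) * m"
    by (simp add: sum_distrib_right)
  also have "\<dots> \<le> T * m"
    using assms(3) \<open>m \<ge> 0\<close> by (rule mult_right_mono)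
  finally show ?thesis by (simp add: m_def)
qed

text \<open>Let \<open>z\<close> be the vector of tested features and \<open>S\<close> its squared
  norm. Testing \<open>z\<close> against itself turns \<open>S\<close> into the pairing of
  \<open>t\<close> with the chaos \<open>G\<close> whose coefficients come from \<open>z\<close>.
  Bounding l1 against the maximum, the maximum by fourth powers summed over \<open>A\<close>, and
  these by the moment bound gives S^4 <= 27 card A N^4 T^4 S^2. Cancelling S^2 leaves sqrt (27 card
  A), rounded up to \<open>6 * sqrt (card A)\<close>.\<close>

lemma chaos_feature_classical_bound:
  fixes t :: "nat \<Rightarrow> nat \<Rightarrow> real"
  assumes "finite A" "A \<noteq> {}"
    and l1: "\<And>x. x \<in> {1..2 ^ n} \<Longrightarrow> (\<Sum>a\<in>A. \<bar>t x a\<bar>) \<le> T"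
  shows "(\<Sum>k\<in>chaos_indices n. (\<Sum>x = 1..2 ^ n. \<Sum>a\<in>A. chaos_feature \<theta> x a k * t x a)\<^sup>2)
    \<le> 6 * sqrt (card A) * (2 ^ n)\<^sup>2 * T\<^sup>2"
proof -
  define N :: nat where "N = 2 ^ n"
  define z where "z = (\<lambda>k. \<Sum>x = 1..N. \<Sum>a\<in>A. chaos_feature \<theta> x a k * t x a)"
  define S where "S = (\<Sum>k\<in>chaos_indices n. (z k)\<^sup>2)"
  define G where "G = (\<lambda>x a. \<Sum>k\<in>chaos_indices n. chaos_feature \<theta> x a k * z k)"
  define m where "m = (\<lambda>x. Max ((\<lambda>a. \<bar>G x a\<bar>) ` A))"
  have "S \<ge> 0" by (simp add: S_def sum_nonneg)
  have G4: "(\<Sum>x = 1..N. G x a ^ 4) \<le> 27 * N * S\<^sup>2" for a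
  proof -
    \<comment> \<open>For a fixed output, the two real coordinates of a pair merge into one chaos
      coefficient. Since (cos, sin) is a unit vector, the sum of squares does not grow.\<close>
    define c where "c = (\<lambda>i j. cos (\<theta> a i j) * z ((j, i), True) + sin (\<theta> a i j) * z ((j, i), False))"
    have "(p * u + q * v)\<^sup>2 \<le> u\<^sup>2 + v\<^sup>2" if "p\<^sup>2 + q\<^sup>2 = 1" for p q u v :: real
    proof -
      have "u\<^sup>2 + v\<^sup>2 = (p\<^sup>2 + q\<^sup>2) * (u\<^sup>2 + v\<^sup>2)" by (simp only: that mult_1)
      also have "\<dots> = (p * u + q * v)\<^sup>2 + (p * v - q * u)\<^sup>2"
        by (simp add: power2_eq_square algebra_simps)
      finally show ?thesis by simp
    qed
    then have c: "(c i j)\<^sup>2 \<le> (z ((j, i), True))\<^sup>2 + (z ((j, i), False))\<^sup>2" for i j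
      unfolding c_def by simp
    have "G x a = (\<Sum>j<n. \<Sum>i<j. c i j * (rsign i x * rsign j x))" for x
      unfolding G_def sum_chaos_indices c_def
      by (intro sum.cong refl) (simp add: chaos_feature_def algebra_simps)
    then have "(\<Sum>x = 1..N. G x a ^ 4) \<le> 27 * N * (\<Sum>j<n. \<Sum>i<j. (c i j)\<^sup>2)\<^sup>2"
      using rademacher_chaos_fourth_moment[of c n] by (simp add: N_def)
    also have "\<dots> \<le> 27 * N * S\<^sup>2"
      unfolding S_def sum_chaos_indices
      by (intro mult_left_mono power_mono sum_mono c) (simp_all add: sum_nonneg)
    finally show ?thesis .
  qed
  \<comment> \<open>Replacing the maximum by the sum over all outputs costs \<open>card A\<close> at
    the fourth power, hence only its square root in the final bound on \<open>S\<close>.\<close>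
  have m: "0 \<le> m x" "m x ^ 4 \<le> (\<Sum>a\<in>A. G x a ^ 4)" for x
  proof -
    have "m x \<in> (\<lambda>a. \<bar>G x a\<bar>) ` A"
      unfolding m_def using assms(1,2) by (intro Max_in) auto
    then obtain a where a: "a \<in> A" "m x = \<bar>G x a\<bar>" by auto
    then show "0 \<le> m x" by simp
    show "m x ^ 4 \<le> (\<Sum>a\<in>A. G x a ^ 4)"
      using member_le_sum[of a A "\<lambda>a. G x a ^ 4"] a assms(1) by simp
  qed
  \<comment> \<open>One of the two factors \<open>z k\<close> is expanded by its definition; the
    other one becomes a coefficient of \<open>G\<close>.\<close>
  have "S = (\<Sum>k\<in>chaos_indices n. \<Sum>x = 1..N. \<Sum>a\<in>A. t x a * (chaos_feature \<theta> x a k * z k))"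
    unfolding S_def
  proof (intro sum.cong refl)
    fix k
    have "(z k)\<^sup>2 = (\<Sum>x = 1..N. \<Sum>a\<in>A. chaos_feature \<theta> x a k * t x a) * z k"
      by (simp only: z_def power2_eq_square)
    then show "(z k)\<^sup>2 = (\<Sum>x = 1..N. \<Sum>a\<in>A. t x a * (chaos_feature \<theta> x a k * z k))"
      by (simp only: sum_distrib_right sum_distrib_left mult_ac)
  qed
  also have "\<dots> = (\<Sum>x = 1..N. \<Sum>a\<in>A. t x a * G x a)"
    unfolding G_def sum_distrib_left by (subst sum.swap) (intro sum.cong refl sum.swap)
  also have "\<dots> \<le> (\<Sum>x = 1..N. T * m x)"
    unfolding m_def
    by (rule sum_mono, rule abs_le_D1, rule sum_abs_mult_le_Max[OF assms(1,2) l1]) (simp add: N_def)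
  finally have "S \<le> T * (\<Sum>x = 1..N. m x)"
    by (simp add: sum_distrib_left)
  then have "S ^ 4 \<le> (T * (\<Sum>x = 1..N. m x)) ^ 4"
    using \<open>S \<ge> 0\<close> by (rule power_mono)
  also have "\<dots> \<le> T ^ 4 * (N ^ 3 * (\<Sum>x = 1..N. m x ^ 4))"
    using sum_power4_le[of "{1..N}" m] m(1) by (simp add: power_mult_distrib mult_left_mono)
  also have "\<dots> \<le> T ^ 4 * (N ^ 3 * (\<Sum>x = 1..N. \<Sum>a\<in>A. G x a ^ 4))"
    by (intro mult_left_mono sum_mono m) simp_all
  also have "\<dots> = T ^ 4 * (N ^ 3 * (\<Sum>a\<in>A. \<Sum>x = 1..N. G x a ^ 4))"
    by (subst sum.swap) (rule refl)
  also have "\<dots> \<le> T ^ 4 * (N ^ 3 * (\<Sum>a\<in>A. 27 * N * S\<^sup>2))"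
    by (intro mult_left_mono sum_mono G4) simp_all
  also have "\<dots> \<le> (6 * sqrt (card A) * (real N)\<^sup>2 * T\<^sup>2)\<^sup>2 * S\<^sup>2"
  proof -
    have "(6 * sqrt (card A) * (real N)\<^sup>2 * T\<^sup>2)\<^sup>2 * S\<^sup>2 - T ^ 4 * (N ^ 3 * (\<Sum>a\<in>A. 27 * N * S\<^sup>2))
        = 9 * (card A * ((real N)\<^sup>2 * T\<^sup>2 * S)\<^sup>2)"
      by (simp add: power_mult_distrib) (simp add: power2_eq_square power3_eq_cube power4_eq_xxxx)
    moreover have "0 \<le> 9 * (card A * ((real N)\<^sup>2 * T\<^sup>2 * S)\<^sup>2)" by simp
    ultimately show ?thesis by linarith
  qed
  finally have "S ^ 4 \<le> (6 * sqrt (card A) * (real N)\<^sup>2 * T\<^sup>2)\<^sup>2 * S\<^sup>2" .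
  then have "(S\<^sup>2)\<^sup>2 \<le> (6 * sqrt (card A) * (real N)\<^sup>2 * T\<^sup>2 * S)\<^sup>2"
    by (simp add: power_mult_distrib)
  then have "S\<^sup>2 \<le> 6 * sqrt (card A) * (real N)\<^sup>2 * T\<^sup>2 * S"
    by (rule power2_le_imp_le) (use \<open>S \<ge> 0\<close> in simp)
  then have "S \<le> 6 * sqrt (card A) * (real N)\<^sup>2 * T\<^sup>2"
    using \<open>S \<ge> 0\<close> by (cases "S = 0") (simp_all add: power2_eq_square)
  then show ?thesis
    by (simp add: S_def z_def N_def)
qed

section \<open>Positive semidefinite matrices\<close>

text \<open>Entries as a function with an explicit size, so that the Cholesky induction can lower
  \<open>m\<close> without cutting blocks out of matrices.\<close>

definition psd_kernel :: "nat \<Rightarrow> (nat \<Rightarrow> nat \<Rightarrow> complex) \<Rightarrow> bool" where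
  "psd_kernel m R \<longleftrightarrow> (\<forall>v. 0 \<le> (\<Sum>i<m. \<Sum>j<m. cnj (v i) * R i j * v j))"

lemma sum_two_points:
  fixes F :: "nat \<Rightarrow> complex"
  assumes "i < m" "j < m"
  shows "(\<Sum>k<m. ((if k = i then 1 else 0) + (if k = j then t else 0)) * F k) = F i + t * F j"
  using assms by (simp add: distrib_right sum.distrib if_distrib[of "\<lambda>z. z * _"] cong: if_cong)

lemma psd_kernel_two_points:
  assumes "psd_kernel m R" "i < m" "j < m"
  shows "0 \<le> R i i + t * R i j + cnj t * (R j i + t * R j j)"
proof -
  define v where "v = (\<lambda>k. (if k = i then 1 else 0) + (if k = j then t else 0))"
  have cv: "cnj (v k) = (if k = i then 1 else 0) + (if k = j then cnj t else 0)" for k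
    by (simp add: v_def)
  have "(\<Sum>k<m. \<Sum>l<m. cnj (v k) * R k l * v l) = (\<Sum>k<m. cnj (v k) * (\<Sum>l<m. v l * R k l))"
    by (simp add: sum_distrib_left mult_ac)
  also have "\<dots> = R i i + t * R i j + cnj t * (R j i + t * R j j)"
    unfolding cv unfolding v_def by (simp only: sum_two_points assms)
  finally show ?thesis
    using assms(1)[unfolded psd_kernel_def, rule_format, of v] by simp
qed

lemma psd_kernel_diag:
  assumes "psd_kernel m R" "i < m"
  shows "0 \<le> R i i"
  using psd_kernel_two_points[OF assms(1,2,2), of 0] by simp

text \<open>Nonnegativity in the complex order includes a vanishing imaginary part. With real
  diagonal entries, the test t = 1 relates the imaginary parts of the two off-diagonal entries, and
  t = \<i> their real parts.\<close>

lemma psd_kernel_hermitian: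
  assumes "psd_kernel m R" "i < m" "j < m"
  shows "R j i = cnj (R i j)"
proof -
  have "Im (R i i) = 0" "Im (R j j) = 0"
    using psd_kernel_diag[OF assms(1)] assms(2,3) by (force simp: less_eq_complex_def)+
  then show ?thesis
    using psd_kernel_two_points[OF assms, of 1] psd_kernel_two_points[OF assms, of \<i>]
    by (simp add: less_eq_complex_def complex_eq_iff)
qed

lemma psd_kernel_zero_diag:
  assumes "psd_kernel m R" "i < m" "j < m" "R j j = 0"
  shows "R i j = 0"
proof (rule ccontr)
  assume "R i j \<noteq> 0"
  \<comment> \<open>With t = - s cnj (R i j) and \<open>R j j = 0\<close> the form is affine in
    \<open>s\<close>; this \<open>s\<close> makes its value -1.\<close>
  define s where "s = (Re (R i i) + 1) / (2 * (cmod (R i j))\<^sup>2)"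
  have pos: "(cmod (R i j))\<^sup>2 > 0" using \<open>R i j \<noteq> 0\<close> by simp
  have "0 \<le> Re (R i i) - 2 * s * (cmod (R i j))\<^sup>2"
    using psd_kernel_two_points[OF assms(1-3), of "- of_real s * cnj (R i j)"]
      psd_kernel_hermitian[OF assms(1-3)] assms(4)
    by (simp add: less_eq_complex_def cmod_power2) (simp add: power2_eq_square algebra_simps)
  moreover have "2 * s * (cmod (R i j))\<^sup>2 = Re (R i i) + 1"
    using pos by (simp add: s_def)
  ultimately show False by simp
qed

text \<open>Cholesky decomposition: each step splits off the last row and column.\<close>

lemma psd_kernel_gram:
  assumes "psd_kernel m R"
  shows "\<exists>w. \<forall>i<m. \<forall>j<m. R i j = (\<Sum>r<m. w r i * cnj (w r j))"
  using assms
proof (induction m arbitrary: R)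
  case (Suc m)
  define s where "s = sqrt (Re (R m m))"
  \<comment> \<open>If \<open>s = 0\<close>, division by zero gives \<open>b = 0\<close>; this is
    consistent because the last column of \<open>R\<close> then vanishes by
    \<open>psd_kernel_zero_diag\<close>.\<close>
  define b where "b = (\<lambda>i. R i m / of_real s)"
  define R' where "R' = (\<lambda>i j. R i j - b i * cnj (b j))"
  have Rm: "R m m = of_real (s\<^sup>2)" "s \<ge> 0"
    using psd_kernel_diag[OF Suc.prems, of m] by (auto simp: s_def less_eq_complex_def complex_eq_iff)
  have herm: "R j i = cnj (R i j)" if "i \<le> m" "j \<le> m" for i j
    by (rule psd_kernel_hermitian[OF Suc.prems]) (use that in simp_all)
  have Rim: "b i * cnj (b m) = R i m" if "i \<le> m" for i
  proof (cases "s = 0")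
    case True
    then show ?thesis
      using psd_kernel_zero_diag[OF Suc.prems, of i m] that Rm by (simp add: b_def)
  next
    case False
    then show ?thesis using Rm by (simp add: b_def power2_eq_square)
  qed
  have R'0: "R' i m = 0" "R' m i = 0" if "i \<le> m" for i
    using Rim[OF that] herm[of i m] that by (auto simp: R'_def mult.commute dest: arg_cong[where f = cnj])
  \<comment> \<open>Completing the square in the last coordinate; \<open>R'\<close> is the Schur
    complement, with zero last row and column.\<close>
  have split: "(\<Sum>i<Suc m. \<Sum>j<Suc m. cnj (v i) * R i j * v j)
      = (\<Sum>i<m. \<Sum>j<m. cnj (v i) * R' i j * v j) + cnj q * q"
    if q: "q = (\<Sum>j<Suc m. cnj (b j) * v j)" for v q
  proof -
    have "(\<Sum>i<Suc m. \<Sum>j<Suc m. cnj (v i) * R i j * v j)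
        = (\<Sum>i<Suc m. \<Sum>j<Suc m. cnj (v i) * R' i j * v j)
          + (\<Sum>i<Suc m. \<Sum>j<Suc m. (b i * cnj (v i)) * (cnj (b j) * v j))"
      unfolding sum.distrib[symmetric]
      by (intro sum.cong refl) (simp add: R'_def algebra_simps)
    also have "(\<Sum>i<Suc m. \<Sum>j<Suc m. (b i * cnj (v i)) * (cnj (b j) * v j)) = cnj q * q"
      unfolding q sum_product[symmetric] by simp
    also have "(\<Sum>i<Suc m. \<Sum>j<Suc m. cnj (v i) * R' i j * v j)
        = (\<Sum>i<m. \<Sum>j<m. cnj (v i) * R' i j * v j)"
      by (simp add: R'0)
    finally show ?thesis .
  qed
  have "psd_kernel m R'"
    unfolding psd_kernel_def
  proof
    fix v :: "nat \<Rightarrow> complex"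
    \<comment> \<open>The last coordinate is chosen to make the completed square vanish, so that the
      form of \<open>R'\<close> at \<open>v\<close> is the form of \<open>R\<close> at
      \<open>v'\<close>. When \<open>b m = 0\<close> it is 0 by division by zero, and the square
      vanishes anyway since \<open>b = 0\<close>.\<close>
    define v' where "v' = v(m := - (\<Sum>j<m. cnj (b j) * v j) / cnj (b m))"
    have "(\<Sum>j<Suc m. cnj (b j) * v' j) = 0"
    proof (cases "s = 0")
      case True
      then show ?thesis by (simp add: b_def)
    next
      case False
      then have "b m \<noteq> 0" using Rm by (simp add: b_def)
      then show ?thesis by (simp add: v'_def)
    qed
    from split[OF this[symmetric]]
    have "(\<Sum>i<m. \<Sum>j<m. cnj (v i) * R' i j * v j)
        = (\<Sum>i<Suc m. \<Sum>j<Suc m. cnj (v' i) * R i j * v' j)"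
      by (simp add: v'_def)
    also have "0 \<le> \<dots>"
      using Suc.prems unfolding psd_kernel_def by blast
    finally show "0 \<le> (\<Sum>i<m. \<Sum>j<m. cnj (v i) * R' i j * v j)" .
  qed
  from Suc.IH[OF this] obtain w
    where w: "R' i j = (\<Sum>r<m. w r i * cnj (w r j))" if "i < m" "j < m" for i j by blast
  \<comment> \<open>The old vectors are padded by 0 at position \<open>m\<close>, where
    \<open>R'\<close> vanishes; \<open>b\<close> is the new vector.\<close>
  define w' where "w' = (\<lambda>r i. if r < m then if i < m then w r i else 0 else b i)"
  have "R i j = (\<Sum>r<Suc m. w' r i * cnj (w' r j))" if "i < Suc m" "j < Suc m" for i j
  proof -
    have "R' i j = (\<Sum>r<m. w' r i * cnj (w' r j))"
      using that R'0 w by (cases "i = m"; cases "j = m") (auto simp: w'_def)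
    then show ?thesis by (simp add: w'_def R'_def diff_eq_eq)
  qed
  then show ?case by blast
qed simp

lemma positive_semidefinite_kernel:
  assumes "A \<in> carrier_mat d d"
  shows "positive_semidefinite d A \<longleftrightarrow> psd_kernel d (\<lambda>i j. A $$ (i, j))"
proof -
  have form: "(A *\<^sub>v v) \<bullet>c v = (\<Sum>i<d. \<Sum>j<d. cnj (v $ i) * A $$ (i, j) * v $ j)"
    if "v \<in> carrier_vec d" for v
    using assms that
    by (auto simp: scalar_prod_def sum_distrib_left sum_distrib_right atLeast0LessThan mult_ac intro!: sum.cong)
  show ?thesis
  proof
    assume psd: "positive_semidefinite d A"
    show "psd_kernel d (\<lambda>i j. A $$ (i, j))"
      unfolding psd_kernel_def
    proof
      fix v :: "nat \<Rightarrow> complex"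
      have "0 \<le> (A *\<^sub>v vec d v) \<bullet>c vec d v"
        using psd by (simp add: positive_semidefinite_def)
      also have "\<dots> = (\<Sum>i<d. \<Sum>j<d. cnj (v i) * A $$ (i, j) * v j)"
        by (simp add: form)
      finally show "0 \<le> (\<Sum>i<d. \<Sum>j<d. cnj (v i) * A $$ (i, j) * v j)" .
    qed
  next
    assume "psd_kernel d (\<lambda>i j. A $$ (i, j))"
    then show "positive_semidefinite d A"
      using assms form by (simp add: positive_semidefinite_def psd_kernel_def)
  qed
qed

lemma positive_semidefinite_gram:
  assumes "positive_semidefinite d A"
  obtains w where "\<And>i j. i < d \<Longrightarrow> j < d \<Longrightarrow> A $$ (i, j) = (\<Sum>r<d. w r i * cnj (w r j))"
proof -
  have "A \<in> carrier_mat d d"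
    using assms by (simp add: positive_semidefinite_def)
  then have "psd_kernel d (\<lambda>i j. A $$ (i, j))"
    using assms by (simp add: positive_semidefinite_kernel)
  from psd_kernel_gram[OF this] show ?thesis
    using that by blast
qed

lemma positive_semidefinite_rank_one:
  "positive_semidefinite d (mat d d (\<lambda>(i, j). w i * cnj (w j)))"
proof -
  have "0 \<le> (\<Sum>i<d. \<Sum>j<d. cnj (v i) * (w i * cnj (w j)) * v j)" for v
  proof -
    have "(\<Sum>i<d. \<Sum>j<d. cnj (v i) * (w i * cnj (w j)) * v j)
        = (\<Sum>i<d. cnj (v i) * w i) * (\<Sum>i<d. cnj (w i) * v i)"
      unfolding sum_product by (simp only: mult_ac)
    also have "\<dots> = (\<Sum>i<d. cnj (v i) * w i) * cnj (\<Sum>i<d. cnj (v i) * w i)"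
      by (simp add: mult.commute)
    also have "\<dots> = complex_of_real ((cmod (\<Sum>i<d. cnj (v i) * w i))\<^sup>2)"
      by (simp only: complex_norm_square)
    also have "0 \<le> \<dots>"
      by (simp add: less_eq_complex_def del: of_real_power)
    finally show ?thesis .
  qed
  then show ?thesis
    by (simp add: positive_semidefinite_kernel psd_kernel_def)
qed

section \<open>Index arithmetic of tensor products\<close>

lemma sum_lessThan_mult:
  fixes f :: "nat \<Rightarrow> 'a::comm_monoid_add"
  shows "(\<Sum>p<d * e. f p) = (\<Sum>i<d. \<Sum>k<e. f (i * e + k))"
proof -
  have "sum f {i * e..<i * e + e} = (\<Sum>k<e. f (i * e + k))" for i
    using sum.shift_bounds_nat_ivl[of f 0 "i * e" e] by (simp add: atLeast0LessThan add.commute)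
  then show ?thesis
    by (simp flip: sum.nat_group)
qed

lemma pair_index_less:
  fixes i k d e :: nat
  assumes "i < d" "k < e"
  shows "i * e + k < d * e"
proof -
  have "i * e + k < Suc i * e" using assms by simp
  also have "\<dots> \<le> d * e" using assms by (intro mult_le_mono1) simp
  finally show ?thesis .
qed

text \<open>The order of summation keeps a column \<open>j\<close> of \<open>E\<close> and a row
  \<open>k\<close> of \<open>F\<close> outside. For fixed \<open>j\<close>, \<open>k\<close>, a Gram
  decomposition of \<rho> then separates the summand into a factor for each party.\<close>

lemma trace_kronecker_mult:
  fixes E F \<rho> :: "'a :: comm_semiring_0 mat"
  assumes "E \<in> carrier_mat d d" "F \<in> carrier_mat d d" "\<rho> \<in> carrier_mat (d * d) (d * d)"
  shows "trace (kronecker E F * \<rho>)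
    = (\<Sum>j<d. \<Sum>k<d. \<Sum>i<d. \<Sum>l<d. E $$ (i, j) * F $$ (k, l) * \<rho> $$ (j * d + l, i * d + k))"
proof -
  have "trace (kronecker E F * \<rho>) = (\<Sum>p<d * d. \<Sum>q<d * d. kronecker E F $$ (p, q) * \<rho> $$ (q, p))"
    using assms by (simp add: trace_def kronecker_def scalar_prod_def atLeast0LessThan)
  also have "\<dots> = (\<Sum>i<d. \<Sum>k<d. \<Sum>j<d. \<Sum>l<d. E $$ (i, j) * F $$ (k, l) * \<rho> $$ (j * d + l, i * d + k))"
    unfolding sum_lessThan_mult
    using assms by (intro sum.cong refl) (simp add: kronecker_def pair_index_less)
  also have "\<dots> = (\<Sum>i<d. \<Sum>j<d. \<Sum>k<d. \<Sum>l<d. E $$ (i, j) * F $$ (k, l) * \<rho> $$ (j * d + l, i * d + k))"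
    by (rule sum.cong[OF refl sum.swap])
  also have "\<dots> = (\<Sum>j<d. \<Sum>i<d. \<Sum>k<d. \<Sum>l<d. E $$ (i, j) * F $$ (k, l) * \<rho> $$ (j * d + l, i * d + k))"
    by (rule sum.swap)
  also have "\<dots> = (\<Sum>j<d. \<Sum>k<d. \<Sum>i<d. \<Sum>l<d. E $$ (i, j) * F $$ (k, l) * \<rho> $$ (j * d + l, i * d + k))"
    by (rule sum.cong[OF refl sum.swap])
  finally show ?thesis .
qed

section \<open>Strategies of dimension d\<close>

lemma povm_sum:
  assumes "povm d K E" "i < d" "j < d"
  shows "(\<Sum>a = 1..K. E a $$ (i, j)) = (if i = j then 1 else 0)"
proof -
  have "mat d d (\<lambda>(i, j). \<Sum>a = 1..K. E a $$ (i, j)) $$ (i, j) = 1\<^sub>m d $$ (i, j)"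
    using assms(1) by (simp add: povm_def)
  then show ?thesis using assms by simp
qed

text \<open>Cauchy--Schwarz for the positive form \<open>(u, v) \<mapsto> \<langle>u, E v\<rangle>\<close>, summed over the outcomes.\<close>

lemma povm_column_l1:
  assumes "povm d K E" "j < d"
  shows "(\<Sum>a = 1..K. cmod (\<Sum>i<d. E a $$ (i, j) * u i)) \<le> sqrt (\<Sum>i<d. (cmod (u i))\<^sup>2)"
proof -
  have "\<exists>w. \<forall>i<d. \<forall>j<d. E a $$ (i, j) = (\<Sum>r<d. w r i * cnj (w r j))" if "a \<in> {1..K}" for a
  proof -
    have "positive_semidefinite d (E a)" using assms(1) that by (simp add: povm_def)
    then show ?thesis by (rule positive_semidefinite_gram) blast
  qed
  then obtain w where
    w: "\<And>a i j. a \<in> {1..K} \<Longrightarrow> i < d \<Longrightarrow> j < d \<Longrightarrow> E a $$ (i, j) = (\<Sum>r<d. w a r i * cnj (w a r j))"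
    by metis
  define p where "p = (\<lambda>a r. \<Sum>i<d. w a r i * u i)"
  define S where "S = {1..K} \<times> {..<d}"
  have "(\<Sum>i<d. E a $$ (i, j) * u i) = (\<Sum>r<d. p a r * cnj (w a r j))" if "a \<in> {1..K}" for a
  proof -
    have "(\<Sum>i<d. E a $$ (i, j) * u i) = (\<Sum>i<d. \<Sum>r<d. w a r i * u i * cnj (w a r j))"
      using that assms(2) by (simp add: w sum_distrib_left sum_distrib_right mult_ac)
    also have "\<dots> = (\<Sum>r<d. p a r * cnj (w a r j))"
      by (subst sum.swap) (simp add: p_def sum_distrib_right)
    finally show ?thesis .
  qed
  then have "(\<Sum>a = 1..K. cmod (\<Sum>i<d. E a $$ (i, j) * u i))
      \<le> (\<Sum>a = 1..K. \<Sum>r<d. cmod (p a r) * cmod (w a r j))"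
    by (intro sum_mono) (simp add: norm_mult sum_norm_le)
  also have "\<dots> = (\<Sum>(a, r)\<in>S. cmod (p a r) * cmod (w a r j))"
    by (simp add: S_def sum.cartesian_product)
  also have "\<dots> \<le> sqrt (\<Sum>i<d. (cmod (u i))\<^sup>2)"
  proof (rule power2_le_imp_le)
    \<comment> \<open>Cauchy-Schwarz over outcome and Gram index jointly. Both factors are then
      completeness sums: one is the diagonal entry \<open>j\<close> of the identity, the other the
      quadratic form of the identity at the conjugate of \<open>u\<close>.\<close>
    have "(\<Sum>(a, r)\<in>S. cmod (p a r) * cmod (w a r j))\<^sup>2
        \<le> (\<Sum>(a, r)\<in>S. (cmod (p a r))\<^sup>2) * (\<Sum>(a, r)\<in>S. (cmod (w a r j))\<^sup>2)"
      using Cauchy_Schwarz_ineq_sum[of "\<lambda>(a, r). cmod (p a r)" "\<lambda>(a, r). cmod (w a r j)" S]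
      by (simp add: case_prod_unfold)
    also have "(\<Sum>(a, r)\<in>S. (cmod (w a r j))\<^sup>2) = 1"
    proof -
      have "complex_of_real (\<Sum>(a, r)\<in>S. (cmod (w a r j))\<^sup>2) = (\<Sum>a = 1..K. E a $$ (j, j))"
        unfolding S_def sum.cartesian_product[symmetric] of_real_sum complex_norm_square
        using assms(2) by (intro sum.cong refl) (simp add: w)
      also have "\<dots> = complex_of_real 1"
        using povm_sum[OF assms(1) assms(2) assms(2)] by simp
      finally show ?thesis by (simp only: of_real_eq_iff)
    qed
    also have "(\<Sum>(a, r)\<in>S. (cmod (p a r))\<^sup>2) = (\<Sum>i<d. (cmod (u i))\<^sup>2)"
    proof -
      have "complex_of_real (\<Sum>(a, r)\<in>S. (cmod (p a r))\<^sup>2)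
          = (\<Sum>a = 1..K. \<Sum>r<d. \<Sum>i<d. \<Sum>l<d. w a r i * cnj (w a r l) * (u i * cnj (u l)))"
        unfolding S_def sum.cartesian_product[symmetric] of_real_sum complex_norm_square
        unfolding p_def cnj_sum sum_product by (simp add: mult_ac)
      also have "\<dots> = (\<Sum>a = 1..K. \<Sum>i<d. \<Sum>l<d. E a $$ (i, l) * (u i * cnj (u l)))"
      proof (rule sum.cong[OF refl])
        fix a assume a: "a \<in> {1..K}"
        have "(\<Sum>r<d. \<Sum>i<d. \<Sum>l<d. w a r i * cnj (w a r l) * (u i * cnj (u l)))
            = (\<Sum>i<d. \<Sum>r<d. \<Sum>l<d. w a r i * cnj (w a r l) * (u i * cnj (u l)))"
          by (rule sum.swap)
        also have "\<dots> = (\<Sum>i<d. \<Sum>l<d. \<Sum>r<d. w a r i * cnj (w a r l) * (u i * cnj (u l)))"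
          by (rule sum.cong[OF refl sum.swap])
        also have "\<dots> = (\<Sum>i<d. \<Sum>l<d. E a $$ (i, l) * (u i * cnj (u l)))"
          using a by (intro sum.cong refl) (simp add: w sum_distrib_right)
        finally show "(\<Sum>r<d. \<Sum>i<d. \<Sum>l<d. w a r i * cnj (w a r l) * (u i * cnj (u l)))
            = (\<Sum>i<d. \<Sum>l<d. E a $$ (i, l) * (u i * cnj (u l)))" .
      qed
      also have "\<dots> = (\<Sum>i<d. \<Sum>l<d. (\<Sum>a = 1..K. E a $$ (i, l)) * (u i * cnj (u l)))"
        by (simp only: sum.swap[where A = "{1..K}"] sum_distrib_right)
      also have "\<dots> = (\<Sum>i<d. \<Sum>l<d. if i = l then u i * cnj (u l) else 0)"
        by (intro sum.cong refl) (simp add: povm_sum[OF assms(1), unfolded One_nat_def])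
      also have "\<dots> = complex_of_real (\<Sum>i<d. (cmod (u i))\<^sup>2)"
        by (simp add: complex_norm_square del: of_real_power)
      finally show ?thesis by (simp only: of_real_eq_iff)
    qed
    finally show "(\<Sum>(a, r)\<in>S. cmod (p a r) * cmod (w a r j))\<^sup>2 \<le> (sqrt (\<Sum>i<d. (cmod (u i))\<^sup>2))\<^sup>2"
      by (simp add: sum_nonneg)
  qed (simp add: sum_nonneg)
  finally show ?thesis .
qed

text \<open>Effects are Hermitian, so a row is a conjugated column and \<open>povm_column_l1\<close>
  applies to the conjugate of \<open>u\<close>.\<close>

lemma povm_row_l1:
  assumes "povm d K E" "i < d"
  shows "(\<Sum>a = 1..K. cmod (\<Sum>j<d. E a $$ (i, j) * u j)) \<le> sqrt (\<Sum>j<d. (cmod (u j))\<^sup>2)"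
proof -
  have "cmod (\<Sum>j<d. E a $$ (i, j) * u j) = cmod (\<Sum>j<d. E a $$ (j, i) * cnj (u j))"
    if "a \<in> {1..K}" for a
  proof -
    have psd: "positive_semidefinite d (E a)" using assms(1) that by (simp add: povm_def)
    then have "E a \<in> carrier_mat d d" by (simp add: positive_semidefinite_def)
    then have "psd_kernel d (\<lambda>i j. E a $$ (i, j))"
      using psd by (simp add: positive_semidefinite_kernel)
    from psd_kernel_hermitian[OF this]
    have "E a $$ (j, i) = cnj (E a $$ (i, j))" if "j < d" for j
      using that assms(2) by blast
    then have "(\<Sum>j<d. E a $$ (j, i) * cnj (u j)) = cnj (\<Sum>j<d. E a $$ (i, j) * u j)"
      by simp
    then show ?thesis by (simp only: complex_mod_cnj)
  qed
  then show ?thesis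
    using povm_column_l1[OF assms, of "\<lambda>j. cnj (u j)"] by simp
qed

section \<open>From classical coefficients to strategies of dimension d\<close>

lemma sum_cmod_square_le:
  fixes g :: "'x \<Rightarrow> 'a \<Rightarrow> 'k \<Rightarrow> real" and t :: "'x \<Rightarrow> 'a \<Rightarrow> complex"
  assumes real_bound: "\<And>t T. (\<And>x. x \<in> X \<Longrightarrow> (\<Sum>a\<in>A. \<bar>t x a\<bar>) \<le> T) \<Longrightarrow>
      (\<Sum>k\<in>I. (\<Sum>x\<in>X. \<Sum>a\<in>A. g x a k * t x a)\<^sup>2) \<le> C * T\<^sup>2"
    and l1: "\<And>x. x \<in> X \<Longrightarrow> (\<Sum>a\<in>A. cmod (t x a)) \<le> T"
  shows "(\<Sum>k\<in>I. (cmod (\<Sum>x\<in>X. \<Sum>a\<in>A. of_real (g x a k) * t x a))\<^sup>2) \<le> 2 * C * T\<^sup>2"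
proof -
  \<comment> \<open>The features are real, so they act separately on real and imaginary parts; each
    part inherits the l1 bound, whence the factor 2.\<close>
  have "(\<Sum>a\<in>A. \<bar>Re (t x a)\<bar>) \<le> T" "(\<Sum>a\<in>A. \<bar>Im (t x a)\<bar>) \<le> T" if "x \<in> X" for x
    using l1[OF that] sum_mono[of A "\<lambda>a. \<bar>Re (t x a)\<bar>" "\<lambda>a. cmod (t x a)"]
      sum_mono[of A "\<lambda>a. \<bar>Im (t x a)\<bar>" "\<lambda>a. cmod (t x a)"]
    by (simp_all add: abs_Re_le_cmod abs_Im_le_cmod)
  from real_bound[of "\<lambda>x a. Re (t x a)", OF this(1)] real_bound[of "\<lambda>x a. Im (t x a)", OF this(2)]
  show ?thesis
    by (simp add: cmod_power2 sum.distrib)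
qed

lemma sum_bilinear:
  fixes f h :: "'s \<Rightarrow> 'x \<Rightarrow> 'a \<Rightarrow> 'c::comm_semiring_0"
  shows "(\<Sum>x\<in>X. \<Sum>y\<in>Y. \<Sum>a\<in>A. \<Sum>b\<in>B. \<Sum>s\<in>S. f s x a * h s y b)
    = (\<Sum>s\<in>S. (\<Sum>x\<in>X. \<Sum>a\<in>A. f s x a) * (\<Sum>y\<in>Y. \<Sum>b\<in>B. h s y b))"
proof -
  have "(\<Sum>s\<in>S. (\<Sum>x\<in>X. \<Sum>a\<in>A. f s x a) * (\<Sum>y\<in>Y. \<Sum>b\<in>B. h s y b))
      = (\<Sum>s\<in>S. \<Sum>x\<in>X. \<Sum>y\<in>Y. \<Sum>a\<in>A. \<Sum>b\<in>B. f s x a * h s y b)"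
    by (simp only: sum_product)
  also have "\<dots> = (\<Sum>x\<in>X. \<Sum>s\<in>S. \<Sum>y\<in>Y. \<Sum>a\<in>A. \<Sum>b\<in>B. f s x a * h s y b)"
    by (rule sum.swap)
  also have "\<dots> = (\<Sum>x\<in>X. \<Sum>y\<in>Y. \<Sum>s\<in>S. \<Sum>a\<in>A. \<Sum>b\<in>B. f s x a * h s y b)"
    by (intro sum.cong[OF refl] sum.swap)
  also have "\<dots> = (\<Sum>x\<in>X. \<Sum>y\<in>Y. \<Sum>a\<in>A. \<Sum>s\<in>S. \<Sum>b\<in>B. f s x a * h s y b)"
    by (rule sum.cong[OF refl], rule sum.cong[OF refl], rule sum.swap)
  also have "\<dots> = (\<Sum>x\<in>X. \<Sum>y\<in>Y. \<Sum>a\<in>A. \<Sum>b\<in>B. \<Sum>s\<in>S. f s x a * h s y b)"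
    by (rule sum.cong[OF refl], rule sum.cong[OF refl], rule sum.cong[OF refl], rule sum.swap)
  finally show ?thesis by simp
qed

text \<open>A Gram decomposition of \<rho> writes the strategy as a sum over
  \<open>(j, k, r)\<close> of products of one-sided coefficients. There are d^4 such triples, but
  the squared l1 bound of each coefficient is the squared norm of a slice of a Gram vector. On
  either side the slice ignores one of \<open>j\<close>, \<open>k\<close>; summing over that index
  gives \<open>d\<close>, and the remaining sum is the trace of \<rho>.\<close>

lemma quantum_value_factor_bound:
  fixes g :: "nat \<Rightarrow> nat \<Rightarrow> 'k \<Rightarrow> real"
  assumes fin: "finite I"
    and classical: "\<And>t T. (\<And>x. x \<in> {1..N} \<Longrightarrow> (\<Sum>a = 1..K. \<bar>t x a\<bar>) \<le> T) \<Longrightarrow>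
      (\<Sum>k\<in>I. (\<Sum>x = 1..N. \<Sum>a = 1..K. g x a k * t x a)\<^sup>2) \<le> C * T\<^sup>2"
    and P: "P \<in> quantum_set d N K"
  shows "\<bar>bell_pairing N K (\<lambda>x y a b. \<Sum>k\<in>I. g x a k * g y b k) P\<bar> \<le> 2 * C * d"
proof -
  obtain E F \<rho> where \<rho>: "density_operator (d * d) \<rho>"
    and E: "\<And>x. x \<in> {1..N} \<Longrightarrow> povm d K (E x)"
    and F: "\<And>y. y \<in> {1..N} \<Longrightarrow> povm d K (F y)"
    and PEF: "\<And>x y a b. x \<in> {1..N} \<Longrightarrow> y \<in> {1..N} \<Longrightarrow> a \<in> {1..K} \<Longrightarrow> b \<in> {1..K} \<Longrightarrow>
      complex_of_real (P a b x y) = trace (kronecker (E x a) (F y b) * \<rho>)"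
    using P unfolding quantum_set_def by blast
  have carE: "E x a \<in> carrier_mat d d" if "x \<in> {1..N}" "a \<in> {1..K}" for x a
    using E[OF that(1)] that(2) by (simp add: povm_def positive_semidefinite_def)
  have carF: "F x a \<in> carrier_mat d d" if "x \<in> {1..N}" "a \<in> {1..K}" for x a
    using F[OF that(1)] that(2) by (simp add: povm_def positive_semidefinite_def)
  have psd\<rho>: "positive_semidefinite (d * d) \<rho>" and tr\<rho>: "trace \<rho> = 1"
    using \<rho> by (simp_all add: density_operator_def)
  then have car\<rho>: "\<rho> \<in> carrier_mat (d * d) (d * d)"
    by (simp add: positive_semidefinite_def)
  obtain v where v: "\<And>p q. p < d * d \<Longrightarrow> q < d * d \<Longrightarrow> \<rho> $$ (p, q) = (\<Sum>r<d * d. v r p * cnj (v r q))"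
    using positive_semidefinite_gram[OF psd\<rho>] by blast
  have norm_v: "(\<Sum>r<d * d. \<Sum>i<d. \<Sum>k<d. (cmod (v r (i * d + k)))\<^sup>2) = 1"
  proof -
    have "complex_of_real (\<Sum>r<d * d. \<Sum>p<d * d. (cmod (v r p))\<^sup>2) = trace \<rho>"
      unfolding of_real_sum complex_norm_square
      using car\<rho> by (subst sum.swap) (simp add: trace_def v)
    then have "(\<Sum>r<d * d. \<Sum>p<d * d. (cmod (v r p))\<^sup>2) = 1"
      using tr\<rho> of_real_eq_1_iff by metis
    then show ?thesis by (simp only: sum_lessThan_mult)
  qed
  \<comment> \<open>For each Gram vector \<open>v r\<close>, \<alpha> reads the slice with second
    coordinate \<open>k\<close> and \<beta> the slice with first coordinate
    \<open>j\<close>.\<close>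
  define J where "J = {..<d} \<times> {..<d} \<times> {..<d * d}"
  define \<alpha> where "\<alpha> = (\<lambda>(j, k, r) x a. \<Sum>i<d. E x a $$ (i, j) * cnj (v r (i * d + k)))"
  define \<beta> where "\<beta> = (\<lambda>(j, k, r) y b. \<Sum>l<d. F y b $$ (k, l) * v r (j * d + l))"
  define A where "A = (\<lambda>s \<kappa>. \<Sum>x = 1..N. \<Sum>a = 1..K. of_real (g x a \<kappa>) * \<alpha> s x a)"
  define B where "B = (\<lambda>s \<kappa>. \<Sum>y = 1..N. \<Sum>b = 1..K. of_real (g y b \<kappa>) * \<beta> s y b)"
  have tr: "complex_of_real (P a b x y) = (\<Sum>s\<in>J. \<alpha> s x a * \<beta> s y b)"
    if "x \<in> {1..N}" "y \<in> {1..N}" "a \<in> {1..K}" "b \<in> {1..K}" for x y a b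
  proof -
    have "complex_of_real (P a b x y) = (\<Sum>j<d. \<Sum>k<d. \<Sum>i<d. \<Sum>l<d.
        E x a $$ (i, j) * F y b $$ (k, l) * \<rho> $$ (j * d + l, i * d + k))"
      using that by (simp add: PEF trace_kronecker_mult[OF carE carF car\<rho>])
    also have "\<dots> = (\<Sum>j<d. \<Sum>k<d. \<Sum>r<d * d. \<alpha> (j, k, r) x a * \<beta> (j, k, r) y b)"
    proof (rule sum.cong[OF refl], rule sum.cong[OF refl])
      fix j k assume jk: "j \<in> {..<d}" "k \<in> {..<d}"
      define X where "X = (\<lambda>i l r. E x a $$ (i, j) * cnj (v r (i * d + k)) * (F y b $$ (k, l) * v r (j * d + l)))"
      have "(\<Sum>i<d. \<Sum>l<d. E x a $$ (i, j) * F y b $$ (k, l) * \<rho> $$ (j * d + l, i * d + k))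
          = (\<Sum>i<d. \<Sum>l<d. \<Sum>r<d * d. X i l r)"
        using jk by (intro sum.cong refl) (simp add: v pair_index_less X_def, simp add: sum_distrib_left mult_ac)
      also have "\<dots> = (\<Sum>i<d. \<Sum>r<d * d. \<Sum>l<d. X i l r)"
        by (rule sum.cong[OF refl sum.swap])
      also have "\<dots> = (\<Sum>r<d * d. \<Sum>i<d. \<Sum>l<d. X i l r)"
        by (rule sum.swap)
      also have "\<dots> = (\<Sum>r<d * d. \<alpha> (j, k, r) x a * \<beta> (j, k, r) y b)"
        by (simp add: \<alpha>_def \<beta>_def X_def sum_product)
      finally show "(\<Sum>i<d. \<Sum>l<d. E x a $$ (i, j) * F y b $$ (k, l) * \<rho> $$ (j * d + l, i * d + k))
          = (\<Sum>r<d * d. \<alpha> (j, k, r) x a * \<beta> (j, k, r) y b)" .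
    qed
    also have "\<dots> = (\<Sum>s\<in>J. \<alpha> s x a * \<beta> s y b)"
      by (simp add: J_def sum.cartesian_product')
    finally show ?thesis .
  qed
  have "complex_of_real (bell_pairing N K (\<lambda>x y a b. \<Sum>k\<in>I. g x a k * g y b k) P)
      = (\<Sum>x = 1..N. \<Sum>y = 1..N. \<Sum>a = 1..K. \<Sum>b = 1..K. \<Sum>u\<in>J \<times> I.
          (of_real (g x a (snd u)) * \<alpha> (fst u) x a) * (of_real (g y b (snd u)) * \<beta> (fst u) y b))"
    unfolding bell_pairing_def of_real_sum of_real_mult
  proof (intro sum.cong refl)
    fix x y a b assume xyab: "x \<in> {1..N}" "y \<in> {1..N}" "a \<in> {1..K}" "b \<in> {1..K}"
    have "(\<Sum>k\<in>I. complex_of_real (g x a k) * of_real (g y b k)) * (\<Sum>s\<in>J. \<alpha> s x a * \<beta> s y b)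
        = (\<Sum>s\<in>J. \<alpha> s x a * \<beta> s y b) * (\<Sum>k\<in>I. complex_of_real (g x a k) * of_real (g y b k))"
      by (rule mult.commute)
    also have "\<dots> = (\<Sum>s\<in>J. \<Sum>k\<in>I. (of_real (g x a k) * \<alpha> s x a) * (of_real (g y b k) * \<beta> s y b))"
      unfolding sum_product by (simp only: mult_ac)
    also have "\<dots> = (\<Sum>u\<in>J \<times> I. (of_real (g x a (snd u)) * \<alpha> (fst u) x a) * (of_real (g y b (snd u)) * \<beta> (fst u) y b))"
      by (simp add: sum.cartesian_product')
    finally show "(\<Sum>k\<in>I. complex_of_real (g x a k) * of_real (g y b k)) * complex_of_real (P a b x y)
        = (\<Sum>u\<in>J \<times> I. (of_real (g x a (snd u)) * \<alpha> (fst u) x a) * (of_real (g y b (snd u)) * \<beta> (fst u) y b))"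
      using xyab by (simp only: tr)
  qed
  also have "\<dots> = (\<Sum>u\<in>J \<times> I. A (fst u) (snd u) * B (fst u) (snd u))"
    by (simp only: sum_bilinear A_def B_def)
  finally have pairing: "complex_of_real (bell_pairing N K (\<lambda>x y a b. \<Sum>k\<in>I. g x a k * g y b k) P)
      = (\<Sum>s\<in>J. \<Sum>\<kappa>\<in>I. A s \<kappa> * B s \<kappa>)"
    by (simp add: sum.cartesian_product')
  have A: "(\<Sum>\<kappa>\<in>I. (cmod (A (j, k, r) \<kappa>))\<^sup>2) \<le> 2 * C * (\<Sum>i<d. (cmod (v r (i * d + k)))\<^sup>2)"
    if "j < d" for j k r
  proof -
    have "(\<Sum>a = 1..K. cmod (\<alpha> (j, k, r) x a)) \<le> sqrt (\<Sum>i<d. (cmod (v r (i * d + k)))\<^sup>2)"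
      if "x \<in> {1..N}" for x
      using povm_column_l1[OF E[OF that] \<open>j < d\<close>, of "\<lambda>i. cnj (v r (i * d + k))"] by (simp add: \<alpha>_def)
    from sum_cmod_square_le[where t = "\<alpha> (j, k, r)", OF classical this] show ?thesis
      by (simp add: A_def sum_nonneg)
  qed
  have B: "(\<Sum>\<kappa>\<in>I. (cmod (B (j, k, r) \<kappa>))\<^sup>2) \<le> 2 * C * (\<Sum>l<d. (cmod (v r (j * d + l)))\<^sup>2)"
    if "k < d" for j k r
  proof -
    have "(\<Sum>b = 1..K. cmod (\<beta> (j, k, r) y b)) \<le> sqrt (\<Sum>l<d. (cmod (v r (j * d + l)))\<^sup>2)"
      if "y \<in> {1..N}" for y
      using povm_row_l1[OF F[OF that] \<open>k < d\<close>, of "\<lambda>l. v r (j * d + l)"] by (simp add: \<beta>_def)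
    from sum_cmod_square_le[where t = "\<beta> (j, k, r)", OF classical this] show ?thesis
      by (simp add: B_def sum_nonneg)
  qed
  have sumA: "(\<Sum>s\<in>J. \<Sum>\<kappa>\<in>I. (cmod (A s \<kappa>))\<^sup>2) \<le> 2 * C * d"
  proof -
    have "(\<Sum>s\<in>J. \<Sum>\<kappa>\<in>I. (cmod (A s \<kappa>))\<^sup>2)
        = (\<Sum>j<d. \<Sum>k<d. \<Sum>r<d * d. \<Sum>\<kappa>\<in>I. (cmod (A (j, k, r) \<kappa>))\<^sup>2)"
      by (simp add: J_def sum.cartesian_product')
    also have "\<dots> \<le> (\<Sum>j<d. \<Sum>k<d. \<Sum>r<d * d. 2 * C * (\<Sum>i<d. (cmod (v r (i * d + k)))\<^sup>2))"
      by (intro sum_mono A) simp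
    \<comment> \<open>The bound does not involve \<open>j\<close>, which therefore contributes the
      factor \<open>d\<close>. For \<open>B\<close> the free index is \<open>k\<close>.\<close>
    also have "\<dots> = 2 * C * d * (\<Sum>k<d. \<Sum>r<d * d. \<Sum>i<d. (cmod (v r (i * d + k)))\<^sup>2)"
      by (simp add: sum_distrib_left[symmetric])
    also have "(\<Sum>k<d. \<Sum>r<d * d. \<Sum>i<d. (cmod (v r (i * d + k)))\<^sup>2)
        = (\<Sum>r<d * d. \<Sum>k<d. \<Sum>i<d. (cmod (v r (i * d + k)))\<^sup>2)"
      by (rule sum.swap)
    also have "\<dots> = 1"
      unfolding norm_v[symmetric] by (rule sum.cong[OF refl sum.swap])
    finally show ?thesis by simp
  qed
  have sumB: "(\<Sum>s\<in>J. \<Sum>\<kappa>\<in>I. (cmod (B s \<kappa>))\<^sup>2) \<le> 2 * C * d"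
  proof -
    have "(\<Sum>s\<in>J. \<Sum>\<kappa>\<in>I. (cmod (B s \<kappa>))\<^sup>2)
        = (\<Sum>j<d. \<Sum>k<d. \<Sum>r<d * d. \<Sum>\<kappa>\<in>I. (cmod (B (j, k, r) \<kappa>))\<^sup>2)"
      by (simp add: J_def sum.cartesian_product')
    also have "\<dots> \<le> (\<Sum>j<d. \<Sum>k<d. \<Sum>r<d * d. 2 * C * (\<Sum>l<d. (cmod (v r (j * d + l)))\<^sup>2))"
      by (intro sum_mono B) simp
    also have "\<dots> = 2 * C * d * (\<Sum>j<d. \<Sum>r<d * d. \<Sum>l<d. (cmod (v r (j * d + l)))\<^sup>2)"
      by (simp add: sum_distrib_left[symmetric])
    also have "(\<Sum>j<d. \<Sum>r<d * d. \<Sum>l<d. (cmod (v r (j * d + l)))\<^sup>2) = 1"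
      unfolding norm_v[symmetric] by (rule sum.swap)
    finally show ?thesis by simp
  qed
  have "\<bar>bell_pairing N K (\<lambda>x y a b. \<Sum>k\<in>I. g x a k * g y b k) P\<bar>
      = cmod (\<Sum>s\<in>J. \<Sum>\<kappa>\<in>I. A s \<kappa> * B s \<kappa>)"
    by (simp only: pairing[symmetric] norm_of_real)
  also have "\<dots> \<le> (\<Sum>s\<in>J. \<Sum>\<kappa>\<in>I. cmod (A s \<kappa> * B s \<kappa>))"
    by (intro sum_norm_le order_refl)
  \<comment> \<open>Both sides obey the same total bound, so the arithmetic-geometric mean
    inequality loses nothing against Cauchy-Schwarz here.\<close>
  also have "\<dots> \<le> (\<Sum>s\<in>J. \<Sum>\<kappa>\<in>I. ((cmod (A s \<kappa>))\<^sup>2 + (cmod (B s \<kappa>))\<^sup>2) / 2)"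
  proof (intro sum_mono)
    fix s \<kappa>
    show "cmod (A s \<kappa> * B s \<kappa>) \<le> ((cmod (A s \<kappa>))\<^sup>2 + (cmod (B s \<kappa>))\<^sup>2) / 2"
      using sum_squares_bound[of "cmod (A s \<kappa>)" "cmod (B s \<kappa>)"] by (simp add: norm_mult)
  qed
  also have "\<dots> = ((\<Sum>s\<in>J. \<Sum>\<kappa>\<in>I. (cmod (A s \<kappa>))\<^sup>2) + (\<Sum>s\<in>J. \<Sum>\<kappa>\<in>I. (cmod (B s \<kappa>))\<^sup>2)) / 2"
    by (simp add: sum.distrib flip: sum_divide_distrib)
  also have "\<dots> \<le> 2 * C * d"
    using sumA sumB by simp
  finally show ?thesis .
qed

section \<open>The maximally entangled state\<close>

text \<open>Completeness replaces both effects by the identity and leaves the trace of \<rho>.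
  Consequently a constant functional has the same value on all strategies of every dimension, which
  makes shifting harmless.\<close>

lemma quantum_set_normalized:
  assumes P: "P \<in> quantum_set d N K" and xy: "x \<in> {1..N}" "y \<in> {1..N}"
  shows "(\<Sum>a = 1..K. \<Sum>b = 1..K. P a b x y) = 1"
proof -
  obtain E F \<rho> where \<rho>: "density_operator (d * d) \<rho>"
    and E: "\<And>x. x \<in> {1..N} \<Longrightarrow> povm d K (E x)"
    and F: "\<And>y. y \<in> {1..N} \<Longrightarrow> povm d K (F y)"
    and PEF: "\<And>x y a b. x \<in> {1..N} \<Longrightarrow> y \<in> {1..N} \<Longrightarrow> a \<in> {1..K} \<Longrightarrow> b \<in> {1..K} \<Longrightarrow>
      complex_of_real (P a b x y) = trace (kronecker (E x a) (F y b) * \<rho>)"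
    using P unfolding quantum_set_def by blast
  have carE: "E x a \<in> carrier_mat d d" if "a \<in> {1..K}" for a
    using E[OF xy(1)] that by (simp add: povm_def positive_semidefinite_def)
  have carF: "F y b \<in> carrier_mat d d" if "b \<in> {1..K}" for b
    using F[OF xy(2)] that by (simp add: povm_def positive_semidefinite_def)
  have car\<rho>: "\<rho> \<in> carrier_mat (d * d) (d * d)" and tr\<rho>: "trace \<rho> = 1"
    using \<rho> by (simp_all add: density_operator_def positive_semidefinite_def)
  have "complex_of_real (\<Sum>a = 1..K. \<Sum>b = 1..K. P a b x y)
      = (\<Sum>a = 1..K. \<Sum>b = 1..K. \<Sum>j<d. \<Sum>k<d. \<Sum>i<d. \<Sum>l<d.
          E x a $$ (i, j) * F y b $$ (k, l) * \<rho> $$ (j * d + l, i * d + k))"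
    unfolding of_real_sum
  proof (rule sum.cong[OF refl], rule sum.cong[OF refl])
    fix a b assume ab: "a \<in> {1..K}" "b \<in> {1..K}"
    show "complex_of_real (P a b x y) = (\<Sum>j<d. \<Sum>k<d. \<Sum>i<d. \<Sum>l<d.
          E x a $$ (i, j) * F y b $$ (k, l) * \<rho> $$ (j * d + l, i * d + k))"
      unfolding PEF[OF xy ab] by (rule trace_kronecker_mult[OF carE[OF ab(1)] carF[OF ab(2)] car\<rho>])
  qed
  also have "\<dots> = (\<Sum>j<d. \<Sum>k<d. \<Sum>i<d. \<Sum>l<d.
      (\<Sum>a = 1..K. E x a $$ (i, j)) * (\<Sum>b = 1..K. F y b $$ (k, l)) * \<rho> $$ (j * d + l, i * d + k))"
    by (simp only: sum.swap[where A = "{1..K}" and B = "{..<d}"] sum_product)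
       (simp only: sum_distrib_right)
  also have "\<dots> = (\<Sum>j<d. \<Sum>k<d. \<rho> $$ (j * d + k, j * d + k))"
  proof (rule sum.cong[OF refl], rule sum.cong[OF refl])
    fix j k assume jk: "j \<in> {..<d}" "k \<in> {..<d}"
    have "(\<Sum>i<d. \<Sum>l<d. (\<Sum>a = 1..K. E x a $$ (i, j)) * (\<Sum>b = 1..K. F y b $$ (k, l)) * \<rho> $$ (j * d + l, i * d + k))
        = (\<Sum>i<d. \<Sum>l<d. if i = j \<and> k = l then \<rho> $$ (j * d + l, i * d + k) else 0)"
      using jk by (intro sum.cong refl) (simp only: lessThan_iff povm_sum[OF E[OF xy(1)]] povm_sum[OF F[OF xy(2)]], simp)
    also have "\<dots> = (\<Sum>i<d. if i = j then \<rho> $$ (j * d + k, i * d + k) else 0)"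
      using jk by (intro sum.cong refl) simp
    finally show "(\<Sum>i<d. \<Sum>l<d. (\<Sum>a = 1..K. E x a $$ (i, j)) * (\<Sum>b = 1..K. F y b $$ (k, l)) * \<rho> $$ (j * d + l, i * d + k))
        = \<rho> $$ (j * d + k, j * d + k)"
      using jk by simp
  qed
  also have "\<dots> = trace \<rho>"
    using car\<rho> by (simp add: trace_def sum_lessThan_mult)
  finally have "complex_of_real (\<Sum>a = 1..K. \<Sum>b = 1..K. P a b x y) = complex_of_real 1"
    by (simp add: tr\<rho>)
  then show ?thesis by (simp only: of_real_eq_iff)
qed

lemma bell_pairing_add_const:
  assumes "P \<in> quantum_set d N K"
  shows "bell_pairing N K (\<lambda>x y a b. M x y a b + \<delta>) P = bell_pairing N K M P + \<delta> * (real N)\<^sup>2"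
proof -
  have "bell_pairing N K (\<lambda>x y a b. M x y a b + \<delta>) P
      = bell_pairing N K M P + \<delta> * (\<Sum>x = 1..N. \<Sum>y = 1..N. \<Sum>a = 1..K. \<Sum>b = 1..K. P a b x y)"
    unfolding bell_pairing_def by (simp add: distrib_right sum.distrib sum_distrib_left)
  also have "(\<Sum>x = 1..N. \<Sum>y = 1..N. \<Sum>a = 1..K. \<Sum>b = 1..K. P a b x y) = (\<Sum>x = 1..N. \<Sum>y = 1..N. 1)"
    by (intro sum.cong refl quantum_set_normalized[OF assms])
  finally show ?thesis by (simp add: power2_eq_square)
qed

definition max_entangled :: "nat \<Rightarrow> complex mat" where
  "max_entangled d = (let w = (\<lambda>p. if p div d = p mod d then complex_of_real (1 / sqrt d) else 0)
     in mat (d * d) (d * d) (\<lambda>(p, q). w p * cnj (w q)))"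

lemma index_max_entangled:
  assumes "i < d" "j < d" "k < d" "l < d"
  shows "max_entangled d $$ (i * d + k, j * d + l) = (if i = k \<and> j = l then 1 / of_nat d else 0)"
proof -
  have "complex_of_real (1 / sqrt d) * complex_of_real (1 / sqrt d) = 1 / of_nat d"
    by (simp flip: of_real_mult)
  then show ?thesis
    using assms by (auto simp: max_entangled_def Let_def pair_index_less)
qed

lemma density_operator_max_entangled:
  assumes "d \<ge> 1"
  shows "density_operator (d * d) (max_entangled d)"
proof -
  have "trace (max_entangled d) = (\<Sum>p<d * d. max_entangled d $$ (p, p))"
    by (simp add: trace_def max_entangled_def Let_def)
  also have "\<dots> = (\<Sum>i<d. \<Sum>k<d. if i = k then 1 / of_nat d else 0)"
    unfolding sum_lessThan_mult by (intro sum.cong refl) (simp add: index_max_entangled)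
  also have "\<dots> = 1"
    using assms by simp
  finally show ?thesis
    by (simp add: density_operator_def max_entangled_def Let_def positive_semidefinite_rank_one)
qed

text \<open>The right-hand side is the trace of E times the transpose of F, divided by
  \<open>d\<close>. Because of this transposition the second party will measure in the conjugate
  basis.\<close>

lemma trace_kronecker_max_entangled:
  assumes "E \<in> carrier_mat d d" "F \<in> carrier_mat d d"
  shows "trace (kronecker E F * max_entangled d) = (\<Sum>i<d. \<Sum>j<d. E $$ (i, j) * F $$ (i, j)) / of_nat d"
proof -
  have "max_entangled d \<in> carrier_mat (d * d) (d * d)"
    by (simp add: max_entangled_def Let_def)
  from trace_kronecker_mult[OF assms this]
  have "trace (kronecker E F * max_entangled d)
      = (\<Sum>j<d. \<Sum>k<d. \<Sum>i<d. \<Sum>l<d. if j = l \<and> i = k then E $$ (i, j) * F $$ (k, l) / of_nat d else 0)"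
    by (simp add: index_max_entangled if_distrib[of "\<lambda>z. _ * z"] cong: if_cong)
  also have "\<dots> = (\<Sum>j<d. \<Sum>k<d. \<Sum>i<d. if i = k then E $$ (i, j) * F $$ (k, j) / of_nat d else 0)"
    by (intro sum.cong refl) simp
  also have "\<dots> = (\<Sum>j<d. \<Sum>k<d. E $$ (k, j) * F $$ (k, j) / of_nat d)"
    by simp
  also have "\<dots> = (\<Sum>k<d. \<Sum>j<d. E $$ (k, j) * F $$ (k, j) / of_nat d)"
    by (rule sum.swap)
  finally show ?thesis
    by (simp flip: sum_divide_distrib)
qed

lemma quantum_set_nonempty:
  assumes "d \<ge> 1" "K \<ge> 1"
  shows "quantum_set d N K \<noteq> {}"
proof -
  define E where "E = (\<lambda>a::nat. if a = 1 then 1\<^sub>m d else 0\<^sub>m d d :: complex mat)"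
  have "psd_kernel d (\<lambda>i j. E a $$ (i, j))" for a
    unfolding psd_kernel_def
  proof
    fix v :: "nat \<Rightarrow> complex"
    have "(\<Sum>i<d. \<Sum>j<d. cnj (v i) * E a $$ (i, j) * v j)
        = (\<Sum>i<d. \<Sum>j<d. if i = j then (if a = 1 then complex_of_real ((cmod (v i))\<^sup>2) else 0) else 0)"
      unfolding complex_norm_square by (intro sum.cong refl) (simp add: E_def)
    also have "\<dots> = complex_of_real (\<Sum>i<d. if a = 1 then (cmod (v i))\<^sup>2 else 0)"
      by (cases "a = 1") simp_all
    also have "0 \<le> \<dots>"
      unfolding less_eq_complex_def by (simp add: sum_nonneg)
    finally show "0 \<le> (\<Sum>i<d. \<Sum>j<d. cnj (v i) * E a $$ (i, j) * v j)" .
  qed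
  moreover have car: "E a \<in> carrier_mat d d" for a
    by (simp add: E_def)
  ultimately have "positive_semidefinite d (E a)" for a
    by (simp add: positive_semidefinite_kernel)
  moreover have "mat d d (\<lambda>(i, j). \<Sum>a = 1..K. E a $$ (i, j)) = 1\<^sub>m d"
  proof (rule eq_matI)
    fix i j assume "i < dim_row (1\<^sub>m d :: complex mat)" "j < dim_col (1\<^sub>m d :: complex mat)"
    then have ij: "i < d" "j < d" by simp_all
    have "(\<Sum>a = 1..K. E a $$ (i, j)) = (\<Sum>a = 1..K. if a = 1 then 1\<^sub>m d $$ (i, j) else 0)"
      using ij by (intro sum.cong refl) (simp add: E_def)
    also have "\<dots> = 1\<^sub>m d $$ (i, j)"
      using assms(2) by simp
    finally show "mat d d (\<lambda>(i, j). \<Sum>a = 1..K. E a $$ (i, j)) $$ (i, j) = 1\<^sub>m d $$ (i, j)"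
      using ij by simp
  qed simp_all
  ultimately have povm: "povm d K E"
    by (simp add: povm_def)
  have "complex_of_real (if a = 1 \<and> b = 1 then 1 else 0) = trace (kronecker (E a) (E b) * max_entangled d)"
    for a b :: nat
  proof -
    have "(\<Sum>i<d. \<Sum>j<d. E a $$ (i, j) * E b $$ (i, j))
        = (\<Sum>i<d. \<Sum>j<d. if i = j then (if a = 1 \<and> b = 1 then 1 else 0) else 0)"
      by (intro sum.cong refl) (simp add: E_def)
    also have "\<dots> = (if a = 1 \<and> b = 1 then of_nat d else 0)"
      by simp
    finally show ?thesis
      using assms(1) by (simp add: trace_kronecker_max_entangled[OF car car])
  qed
  then have "(\<lambda>a b x y. if a = 1 \<and> b = 1 then 1 else 0) \<in> quantum_set d N K"
    unfolding quantum_set_def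
    using povm density_operator_max_entangled[OF assms(1)]
    by (intro CollectI exI[of _ "\<lambda>_. E"] exI[of _ "max_entangled d"]) auto
  then show ?thesis by blast
qed

section \<open>Fourier bases and squared moduli of trigonometric sums\<close>

lemma sum_cis_roots_of_unity:
  assumes "i < n" "j < n"
  shows "(\<Sum>a = 1..n. cis (2 * pi * real a * (real i - real j) / real n)) = (if i = j then of_nat n else 0)"
proof (cases "i = j")
  case False
  define z where "z = cis (2 * pi * (real i - real j) / real n)"
  have n: "real n > 0" using assms by simp
  have pow: "z ^ a = cis (2 * pi * real a * (real i - real j) / real n)" for a
    by (simp add: z_def Complex.DeMoivre mult_ac)
  have "z ^ n = cis (2 * pi * (real i - real j))"
    unfolding pow by (rule arg_cong[where f = cis]) (use n in simp)
  also have "\<dots> = 1"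
    by (rule cis_multiple_2pi) simp
  finally have "z ^ n = 1" .
  have "z \<noteq> 1"
  proof
    assume "z = 1"
    then have "cos (2 * pi * (real i - real j) / real n) = 1"
      by (auto simp: z_def complex_eq_iff)
    then obtain k :: int where "2 * pi * (real i - real j) / real n = of_int k * 2 * pi"
      by (auto simp: cos_one_2pi_int)
    then have "(2 * pi) * (real i - real j) = (2 * pi) * (of_int k * real n)"
      using n by (simp add: field_simps)
    then have "real i - real j = of_int k * real n"
      by (subst (asm) mult_cancel_left) simp
    then have eq: "int i - int j = k * int n"
      by (metis (mono_tags, opaque_lifting) of_int_diff of_int_eq_iff of_int_mult of_int_of_nat_eq)
    then have "int n dvd int i - int j" by simp
    then have "\<bar>int n\<bar> \<le> \<bar>int i - int j\<bar>"
      using False by (intro dvd_imp_le_int) auto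
    then show False using assms by linarith
  qed
  have "(\<Sum>a = 1..n. cis (2 * pi * real a * (real i - real j) / real n)) = (\<Sum>a<n. z ^ Suc a)"
    unfolding pow One_nat_def by (rule sum.atLeast1_atMost_eq)
  also have "\<dots> = z * ((z ^ n - 1) / (z - 1))"
    using geometric_sum[OF \<open>z \<noteq> 1\<close>, of n] by (simp flip: sum_distrib_left)
  finally show ?thesis
    using False \<open>z ^ n = 1\<close> by simp
qed simp

lemma cmod_sum_cis_square:
  fixes n :: nat
  shows "(cmod (\<Sum>i<n. of_real (e i) * cis (\<phi> i)))\<^sup>2
    = (\<Sum>i<n. (e i)\<^sup>2) + 2 * (\<Sum>j<n. \<Sum>i<j. e i * e j * cos (\<phi> i - \<phi> j))"
proof -
  have "(\<Sum>i<n. e i * cos (\<phi> i))\<^sup>2 + (\<Sum>i<n. e i * sin (\<phi> i))\<^sup>2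
      = (\<Sum>i<n. (e i)\<^sup>2) + 2 * (\<Sum>j<n. \<Sum>i<j. e i * e j * cos (\<phi> i - \<phi> j))"
  proof (induction n)
    case (Suc n)
    define C where "C = (\<Sum>i<n. e i * cos (\<phi> i))"
    define S where "S = (\<Sum>i<n. e i * sin (\<phi> i))"
    have "(\<Sum>i<n. e i * e n * cos (\<phi> i - \<phi> n)) = e n * cos (\<phi> n) * C + e n * sin (\<phi> n) * S"
      by (simp add: C_def S_def cos_diff sum_distrib_left distrib_left sum.distrib mult_ac)
    moreover have "(e n * cos (\<phi> n))\<^sup>2 + (e n * sin (\<phi> n))\<^sup>2 = (e n)\<^sup>2"
      by (simp add: power_mult_distrib flip: distrib_left)
    ultimately show ?case
      using Suc.IH by (simp add: power2_sum C_def[symmetric] S_def[symmetric] distrib_left)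
  qed simp
  then show ?thesis
    by (simp add: cmod_power2)
qed

section \<open>A violating functional\<close>

definition fourier_phase :: "nat \<Rightarrow> nat \<Rightarrow> nat \<Rightarrow> nat \<Rightarrow> real" where
  "fourier_phase n a i j = 2 * pi * real a * (real i - real j) / real n"

definition chaos_functional :: "nat \<Rightarrow> nat \<Rightarrow> nat \<Rightarrow> nat \<Rightarrow> nat \<Rightarrow> real" where
  "chaos_functional n x y a b = (\<Sum>k\<in>chaos_indices n.
     chaos_feature (fourier_phase n) x a k * chaos_feature (fourier_phase n) y b k)"

text \<open>Addition theorem for the cosine. The signs are grouped by index so that the summand
  matches \<open>e i * e j * cos (\<phi> i - \<phi> j)\<close> in
  \<open>cmod_sum_cis_square\<close>.\<close>

lemma chaos_functional_eq:
  "chaos_functional n x y a b = (\<Sum>j<n. \<Sum>i<j.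
     (rsign i x * rsign i y) * (rsign j x * rsign j y) * cos (fourier_phase n a i j - fourier_phase n b i j))"
  unfolding chaos_functional_def sum_chaos_indices
  by (intro sum.cong refl) (simp add: chaos_feature_def cos_diff algebra_simps)

text \<open>The probability is the squared modulus of an inner product of two basis vectors, divided
  by \<open>n\<close> for the state. The normalization of the vectors contributes another 1 / n^2,
  hence \<open>real n ^ 3\<close>; the constant \<open>real n\<close> is the diagonal of the
  expanded square.\<close>

lemma chaos_strategy_mem_quantum_set:
  assumes "n \<ge> 1"
  shows "(\<lambda>a b x y. (real n + 2 * chaos_functional n x y a b) / real n ^ 3) \<in> quantum_set n N n"
proof -
  define v where "v = (\<lambda>x a i. complex_of_real (rsign i x / sqrt n) * cis (2 * pi * real a * real i / real n))"
  define E where "E = (\<lambda>x a. mat n n (\<lambda>(i, j). v x a i * cnj (v x a j)))"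
  \<comment> \<open>The conjugate basis undoes the transposition by the state. The double conjugate
    keeps the shape required by \<open>positive_semidefinite_rank_one\<close>.\<close>
  define F where "F = (\<lambda>y b. mat n n (\<lambda>(i, j). cnj (v y b i) * cnj (cnj (v y b j))))"
  have vv: "v x a i * cnj (v x a j) = of_real (rsign i x * rsign j x / n) * cis (fourier_phase n a i j)"
    for x a i j
  proof -
    have "v x a i * cnj (v x a j) = of_real (rsign i x / sqrt n * (rsign j x / sqrt n))
        * (cis (2 * pi * real a * real i / real n) * cis (- (2 * pi * real a * real j / real n)))"
      by (simp only: v_def complex_cnj_mult complex_cnj_complex_of_real cis_cnj of_real_mult mult_ac)
    also have "rsign i x / sqrt n * (rsign j x / sqrt n) = rsign i x * rsign j x / n"
      by simp
    also have "cis (2 * pi * real a * real i / real n) * cis (- (2 * pi * real a * real j / real n))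
        = cis (fourier_phase n a i j)"
      unfolding cis_mult fourier_phase_def by (simp add: right_diff_distrib diff_divide_distrib)
    finally show ?thesis .
  qed
  have sum: "(\<Sum>a = 1..n. v x a i * cnj (v x a j)) = (if i = j then 1 else 0)" if "i < n" "j < n" for x i j
  proof -
    have "(\<Sum>a = 1..n. v x a i * cnj (v x a j))
        = of_real (rsign i x * rsign j x / n) * (\<Sum>a = 1..n. cis (fourier_phase n a i j))"
      unfolding vv sum_distrib_left ..
    also have "\<dots> = of_real (rsign i x * rsign j x / n) * (if i = j then of_nat n else 0)"
      unfolding fourier_phase_def sum_cis_roots_of_unity[OF that] ..
    finally show ?thesis
      using assms by (cases "i = j"; simp del: of_real_mult of_real_divide; simp)
  qed
  have povmE: "povm n n (E x)" for x
    unfolding povm_def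
  proof
    show "\<forall>a\<in>{1..n}. positive_semidefinite n (E x a)"
      by (simp add: E_def positive_semidefinite_rank_one)
    show "mat n n (\<lambda>(i, j). \<Sum>a = 1..n. E x a $$ (i, j)) = 1\<^sub>m n"
      using sum[of _ _ x] by (intro eq_matI) (auto simp: E_def)
  qed
  have povmF: "povm n n (F y)" for y
    unfolding povm_def
  proof
    show "\<forall>b\<in>{1..n}. positive_semidefinite n (F y b)"
      unfolding F_def by (intro ballI positive_semidefinite_rank_one[where w = "\<lambda>i. cnj (v y _ i)"])
    have "(\<Sum>b = 1..n. cnj (v y b i) * v y b j) = (if i = j then 1 else 0)" if "i < n" "j < n" for i j
      using sum[OF that(2,1), of y] by (cases "i = j") (simp_all add: mult.commute)
    then show "mat n n (\<lambda>(i, j). \<Sum>b = 1..n. F y b $$ (i, j)) = 1\<^sub>m n"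
      by (intro eq_matI) (auto simp: F_def)
  qed
  have "complex_of_real ((real n + 2 * chaos_functional n x y a b) / real n ^ 3)
      = trace (kronecker (E x a) (F y b) * max_entangled n)" for x y a b
  proof -
    define e where "e = (\<lambda>i. rsign i x * rsign i y)"
    define \<phi> where "\<phi> = (\<lambda>i. 2 * pi * real a * real i / real n - 2 * pi * real b * real i / real n)"
    have w: "v x a i * cnj (v y b i) = of_real (1 / n) * (of_real (e i) * cis (\<phi> i))" for i
    proof -
      have "v x a i * cnj (v y b i) = of_real (rsign i x / sqrt n * (rsign i y / sqrt n))
          * (cis (2 * pi * real a * real i / real n) * cis (- (2 * pi * real b * real i / real n)))"
        by (simp only: v_def complex_cnj_mult complex_cnj_complex_of_real cis_cnj of_real_mult mult_ac)
      also have "rsign i x / sqrt n * (rsign i y / sqrt n) = 1 / n * e i"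
        by (simp add: e_def)
      finally show ?thesis
        by (simp add: cis_mult \<phi>_def)
    qed
    have "(\<Sum>i<n. \<Sum>j<n. E x a $$ (i, j) * F y b $$ (i, j))
        = (\<Sum>i<n. v x a i * cnj (v y b i)) * (\<Sum>j<n. cnj (v x a j) * v y b j)"
      unfolding sum_product by (intro sum.cong refl) (simp add: E_def F_def)
    also have "\<dots> = (\<Sum>i<n. v x a i * cnj (v y b i)) * cnj (\<Sum>i<n. v x a i * cnj (v y b i))"
      by simp
    also have "\<dots> = complex_of_real ((cmod (\<Sum>i<n. v x a i * cnj (v y b i)))\<^sup>2)"
      by (simp only: complex_norm_square)
    also have "(\<Sum>i<n. v x a i * cnj (v y b i)) = of_real (1 / n) * (\<Sum>i<n. of_real (e i) * cis (\<phi> i))"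
      unfolding w sum_distrib_left ..
    also have "(cmod \<dots>)\<^sup>2 = (1 / n)\<^sup>2 * (cmod (\<Sum>i<n. of_real (e i) * cis (\<phi> i)))\<^sup>2"
      unfolding norm_mult power_mult_distrib norm_of_real by simp
    also have "(cmod (\<Sum>i<n. of_real (e i) * cis (\<phi> i)))\<^sup>2 = real n + 2 * chaos_functional n x y a b"
    proof -
      have "\<phi> i - \<phi> j = fourier_phase n a i j - fourier_phase n b i j" for i j
        by (simp add: \<phi>_def fourier_phase_def right_diff_distrib diff_divide_distrib)
      then show ?thesis
        unfolding cmod_sum_cis_square chaos_functional_eq by (simp add: e_def power_mult_distrib)
    qed
    finally show ?thesis
      using assms by (subst trace_kronecker_max_entangled) (simp_all add: E_def F_def power2_eq_square power3_eq_cube)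
  qed
  then show ?thesis
    unfolding quantum_set_def
    using povmE povmF density_operator_max_entangled[OF assms]
    by (intro CollectI exI[of _ E] exI[of _ F] exI[of _ "max_entangled n"]) blast
qed

section \<open>Lower bound for the value in dimension n\<close>

lemma sum_chaos_functional_nonneg:
  "0 \<le> (\<Sum>x = 1..N. \<Sum>y = 1..N. \<Sum>a = 1..K. \<Sum>b = 1..K. chaos_functional n x y a b)"
proof -
  define g where "g = (\<lambda>k x a. chaos_feature (fourier_phase n) x a k)"
  have "(\<Sum>x = 1..N. \<Sum>y = 1..N. \<Sum>a = 1..K. \<Sum>b = 1..K. chaos_functional n x y a b)
      = (\<Sum>k\<in>chaos_indices n. (\<Sum>x = 1..N. \<Sum>a = 1..K. g k x a) * (\<Sum>x = 1..N. \<Sum>a = 1..K. g k x a))"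
    unfolding chaos_functional_def g_def by (rule sum_bilinear)
  also have "0 \<le> \<dots>" by (intro sum_nonneg) simp
  finally show ?thesis .
qed

text \<open>The functional is a Gram kernel of the features, so its Hilbert-Schmidt norm equals that
  of the feature correlation matrix \<open>h\<close>. Keeping only the diagonal of \<open>h\<close>
  suffices: each of the n (n - 1) / 2 pairs contributes at least half of
  \<open>(real N * real K)^2\<close>.\<close>

lemma sum_chaos_functional_square_ge:
  "(real N * real K)\<^sup>2 * (real n * (real n - 1)) / 4
    \<le> (\<Sum>x = 1..N. \<Sum>y = 1..N. \<Sum>a = 1..K. \<Sum>b = 1..K. (chaos_functional n x y a b)\<^sup>2)"
proof -
  define g where "g = (\<lambda>k x a. chaos_feature (fourier_phase n) x a k)"
  define I where "I = chaos_indices n"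
  define h where "h = (\<lambda>k l. \<Sum>x = 1..N. \<Sum>a = 1..K. g k x a * g l x a)"
  have "finite I" by (simp add: I_def)
  have tri: "(\<Sum>j<n. \<Sum>i<j. c) = real n * (real n - 1) / 2 * c" for c :: real
    by (induction n) (simp_all add: field_simps)
  have half: "(u + v)\<^sup>2 / 2 \<le> u\<^sup>2 + v\<^sup>2" for u v :: real
    using sum_squares_bound[of u v] by (simp add: power2_sum)
  \<comment> \<open>By cos^2 + sin^2 = 1 only the sum over the two parts of a pair is known;
    \<open>half\<close> covers the least favourable distribution between them.\<close>
  have diag: "h ((j, i), True) ((j, i), True) + h ((j, i), False) ((j, i), False) = real N * real K" for i j
  proof -
    have "h ((j, i), True) ((j, i), True) + h ((j, i), False) ((j, i), False)
        = (\<Sum>x = 1..N. \<Sum>a = 1..K. 1)"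
      unfolding h_def sum.distrib[symmetric]
      by (intro sum.cong refl)
         (simp add: g_def chaos_feature_def flip: power2_eq_square, simp add: power_mult_distrib)
    then show ?thesis by simp
  qed
  have half_diag: "(real N * real K)\<^sup>2 / 2 \<le> (h ((j, i), True) ((j, i), True))\<^sup>2 + (h ((j, i), False) ((j, i), False))\<^sup>2"
    for i j
    unfolding diag[of j i, symmetric] by (rule half)
  have "(real N * real K)\<^sup>2 * (real n * (real n - 1)) / 4 = (\<Sum>j<n. \<Sum>i<j. (real N * real K)\<^sup>2 / 2)"
    unfolding tri by simp
  also have "\<dots> \<le> (\<Sum>k\<in>I. (h k k)\<^sup>2)"
    unfolding I_def sum_chaos_indices by (intro sum_mono half_diag)
  also have "\<dots> \<le> (\<Sum>k\<in>I. \<Sum>l\<in>I. (h k l)\<^sup>2)"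
    using \<open>finite I\<close> by (intro sum_mono member_le_sum) auto
  also have "\<dots> = (\<Sum>p\<in>I \<times> I. h (fst p) (snd p) * h (fst p) (snd p))"
    by (simp add: sum.cartesian_product' power2_eq_square)
  also have "\<dots> = (\<Sum>x = 1..N. \<Sum>y = 1..N. \<Sum>a = 1..K. \<Sum>b = 1..K. \<Sum>p\<in>I \<times> I.
      (g (fst p) x a * g (snd p) x a) * (g (fst p) y b * g (snd p) y b))"
    unfolding h_def by (rule sum_bilinear[symmetric])
  also have "\<dots> = (\<Sum>x = 1..N. \<Sum>y = 1..N. \<Sum>a = 1..K. \<Sum>b = 1..K. (chaos_functional n x y a b)\<^sup>2)"
    by (intro sum.cong refl)
       (simp add: chaos_functional_def power2_eq_square sum_product sum.cartesian_product' I_def g_def mult_ac)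
  finally show ?thesis .
qed

lemma chaos_strategy_value:
  assumes "n \<ge> 2"
  shows "(real N)\<^sup>2 * real n / 4
    \<le> bell_pairing N n (chaos_functional n) (\<lambda>a b x y. (real n + 2 * chaos_functional n x y a b) / real n ^ 3)"
proof -
  define S1 where "S1 = (\<Sum>x = 1..N. \<Sum>y = 1..N. \<Sum>a = 1..n. \<Sum>b = 1..n. chaos_functional n x y a b)"
  define S2 where "S2 = (\<Sum>x = 1..N. \<Sum>y = 1..N. \<Sum>a = 1..n. \<Sum>b = 1..n. (chaos_functional n x y a b)\<^sup>2)"
  have n: "real n \<ge> 2" using assms by simp
  have "(real N)\<^sup>2 * real n / 4 \<le> (real N)\<^sup>2 * (real n - 1) / 2"
    using n mult_left_mono[of "real n / 4" "(real n - 1) / 2" "(real N)\<^sup>2"] by simp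
  also have "\<dots> = 2 * ((real N * real n)\<^sup>2 * (real n * (real n - 1)) / 4) / real n ^ 3"
    using n by (simp add: field_simps power2_eq_square power3_eq_cube)
  also have "\<dots> \<le> (real n * S1 + 2 * S2) / real n ^ 3"
  proof (rule divide_right_mono)
    have "0 \<le> real n * S1"
      using sum_chaos_functional_nonneg by (simp add: S1_def)
    then show "2 * ((real N * real n)\<^sup>2 * (real n * (real n - 1)) / 4) \<le> real n * S1 + 2 * S2"
      using sum_chaos_functional_square_ge[of N n n] unfolding S2_def by linarith
  qed simp
  also have "\<dots> = bell_pairing N n (chaos_functional n) (\<lambda>a b x y. (real n + 2 * chaos_functional n x y a b) / real n ^ 3)"
    unfolding bell_pairing_def S1_def S2_def sum_distrib_left sum_divide_distrib sum.distrib[symmetric]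
      add_divide_distrib[symmetric]
    by (intro sum.cong refl) (simp add: power2_eq_square algebra_simps)
  finally show ?thesis .
qed

section \<open>Upper bound in dimension d and conclusion\<close>

lemma chaos_functional_dimension_bound:
  assumes "n \<ge> 1" "P \<in> quantum_set d (2 ^ n) n"
  shows "\<bar>bell_pairing (2 ^ n) n (chaos_functional n) P\<bar> \<le> 12 * d * sqrt n * (2 ^ n)\<^sup>2"
proof -
  \<comment> \<open>The 6 is the classical constant, the 2 the price of complex
    coefficients.\<close>
  have "\<bar>bell_pairing (2 ^ n) n (chaos_functional n) P\<bar> \<le> 2 * (6 * sqrt n * (2 ^ n)\<^sup>2) * d"
    unfolding chaos_functional_def
  proof (rule quantum_value_factor_bound[OF finite_chaos_indices _ assms(2)])
    fix t :: "nat \<Rightarrow> nat \<Rightarrow> real" and T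
    assume "\<And>x. x \<in> {1..2 ^ n} \<Longrightarrow> (\<Sum>a = 1..n. \<bar>t x a\<bar>) \<le> T"
    from chaos_feature_classical_bound[OF _ _ this]
    show "(\<Sum>k\<in>chaos_indices n. (\<Sum>x = 1..2 ^ n. \<Sum>a = 1..n. chaos_feature (fourier_phase n) x a k * t x a)\<^sup>2)
        \<le> 6 * sqrt n * (2 ^ n)\<^sup>2 * T\<^sup>2"
      using assms(1) by simp
  qed
  then show ?thesis by (simp add: mult_ac)
qed

theorem theorem4:
  shows "\<exists>c::real. c > 0 \<and> (\<forall>d n :: nat. d \<ge> 1 \<longrightarrow> n \<ge> 2 \<longrightarrow>
    (SUP (N, K, M) \<in> {(N, K, M). N \<ge> 1 \<and> K \<ge> 1 \<and> quantum_value d N K M \<noteq> 0}.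
        quantum_value n N K M / quantum_value d N K M)
      \<ge> ereal (c * (sqrt (real n) / (real d * (log 2 (real n))\<^sup>2))))"
proof (intro exI[of _ "1 / 100"] conjI allI impI)
  fix d n :: nat
  assume d: "d \<ge> 1" and n: "n \<ge> 2"
  define N :: nat where "N = 2 ^ n"
  \<comment> \<open>The shift by \<open>\<delta>\<close> exceeds the value of the chaos in dimension \<open>d\<close>, which makes the denominator nonzero.\<close>
  define \<delta> where "\<delta> = 13 * d * sqrt n"
  define M where "M = (\<lambda>x y a b. chaos_functional n x y a b + \<delta>)"
  \<comment> \<open>25 = 12 + 13: the chaos bound plus the shift. Against the quantum value
    \<open>(real N)^2 * n / 4\<close> this yields the constant 1 / 100.\<close>
  define U where "U = 25 * d * sqrt n * (real N)\<^sup>2"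
  have N: "N \<ge> 1" by (simp add: N_def)
  have pos: "d * sqrt n * (real N)\<^sup>2 > 0" using d n N by simp
  have bound: "\<bar>bell_pairing N n M P - \<delta> * (real N)\<^sup>2\<bar> \<le> 12 * d * sqrt n * (real N)\<^sup>2"
    if "P \<in> quantum_set d N n" for P
    using chaos_functional_dimension_bound[of n P d] bell_pairing_add_const[OF that, of "chaos_functional n" \<delta>] n that
    by (simp add: N_def M_def)
  have upper: "quantum_value d N n M \<le> ereal U"
    unfolding quantum_value_def
  proof (rule SUP_least)
    fix P assume "P \<in> quantum_set d N n"
    from bound[OF this] show "ereal \<bar>bell_pairing N n M P\<bar> \<le> ereal U"
      using pos unfolding U_def \<delta>_def by (simp add: abs_le_iff)
  qed
  obtain P0 where P0: "P0 \<in> quantum_set d N n"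
    using quantum_set_nonempty[OF d, of n N] n by auto
  have "0 < \<bar>bell_pairing N n M P0\<bar>"
    using bound[OF P0] pos unfolding \<delta>_def by (simp add: abs_le_iff)
  moreover have "ereal \<bar>bell_pairing N n M P0\<bar> \<le> quantum_value d N n M"
    unfolding quantum_value_def by (rule SUP_upper[OF P0])
  ultimately have lower: "0 < quantum_value d N n M"
    by (meson ereal_less(2) less_le_trans)
  \<comment> \<open>A finite positive denominator moves the comparison of quotients from the
    extended reals to the reals.\<close>
  obtain q where q: "quantum_value d N n M = ereal q" "0 < q" "q \<le> U"
    using upper lower by (cases "quantum_value d N n M") auto
  let ?P = "\<lambda>a b x y. (real n + 2 * chaos_functional n x y a b) / real n ^ 3"
  have P: "?P \<in> quantum_set n N n"
    using n by (intro chaos_strategy_mem_quantum_set) simp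
  have "(real N)\<^sup>2 * real n / 4 \<le> bell_pairing N n M ?P"
  proof -
    \<comment> \<open>The shift is nonnegative, so in dimension \<open>n\<close> it can only
      increase the value.\<close>
    have "0 \<le> \<delta> * (real N)\<^sup>2" by (simp add: \<delta>_def)
    then show ?thesis
      using chaos_strategy_value[OF n, of N] bell_pairing_add_const[OF P, of "chaos_functional n" \<delta>]
      unfolding M_def by linarith
  qed
  then have "ereal ((real N)\<^sup>2 * real n / 4) \<le> ereal \<bar>bell_pairing N n M ?P\<bar>"
    by simp
  also have "\<dots> \<le> quantum_value n N n M"
    unfolding quantum_value_def by (rule SUP_upper[OF P])
  finally have quantum: "ereal ((real N)\<^sup>2 * real n / 4) \<le> quantum_value n N n M" .
  \<comment> \<open>For \<open>n \<ge> 2\<close> the base-2 logarithm is at least 1, so dividing by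
    its square only weakens the bound.\<close>
  have log: "1 \<le> (log 2 (real n))\<^sup>2"
    using n by (intro one_le_power) simp
  have "1 / 100 * (sqrt n / (d * (log 2 n)\<^sup>2)) \<le> 1 / 100 * (sqrt n / d)"
  proof -
    have "sqrt n / (d * (log 2 n)\<^sup>2) \<le> sqrt n / d"
    proof (rule divide_left_mono)
      show "real d \<le> d * (log 2 n)\<^sup>2"
        using mult_left_mono[OF log, of "real d"] by simp
      have "0 < (log 2 n)\<^sup>2" using log by linarith
      then show "0 < d * (log 2 n)\<^sup>2 * real d" using d by simp
    qed simp
    then show ?thesis by (rule mult_left_mono) simp
  qed
  also have "\<dots> = ((real N)\<^sup>2 * real n / 4) / U"
  proof -
    have "sqrt n * sqrt n = real n" by simp
    moreover have "sqrt n \<noteq> 0" "real d \<noteq> 0" "real N \<noteq> 0" using n d N by auto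
    ultimately show ?thesis
      unfolding U_def by (simp add: divide_simps)
  qed
  also have "\<dots> \<le> ((real N)\<^sup>2 * real n / 4) / q"
    using q by (intro divide_left_mono) auto
  finally have "ereal (1 / 100 * (sqrt n / (d * (log 2 n)\<^sup>2))) \<le> ereal ((real N)\<^sup>2 * real n / 4) / ereal q"
    using q by simp
  also have "\<dots> \<le> quantum_value n N n M / quantum_value d N n M"
    unfolding q(1) using q(2) quantum by (intro ereal_divide_right_mono) auto
  also have "\<dots> \<le> (SUP (N, K, M) \<in> {(N, K, M). N \<ge> 1 \<and> K \<ge> 1 \<and> quantum_value d N K M \<noteq> 0}.
        quantum_value n N K M / quantum_value d N K M)"
    by (rule SUP_upper2[of "(N, n, M)"]) (use N n lower in auto)
  finally show "(SUP (N, K, M) \<in> {(N, K, M). N \<ge> 1 \<and> K \<ge> 1 \<and> quantum_value d N K M \<noteq> 0}.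
        quantum_value n N K M / quantum_value d N K M)
      \<ge> ereal (1 / 100 * (sqrt (real n) / (real d * (log 2 (real n))\<^sup>2)))" .
qed simp

end
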